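(* The class $\mathsf{RDInFL}$ of representable distributive involutive FL-algebras is closed under ultraproducts: $\mathbb P_{\mathbb U}(\mathsf{RDInFL})=\mathsf{RDInFL}$, where $\mathbb P_{\mathbb U}(\mathsf K)$ denotes the class of all ultraproducts of families of members of $\mathsf K$.
   Context: A distributive involutive FL-algebra (DInFL-algebra) is a distributive residuated lattice $\langle A,\wedge,\vee,\cdot,1,\backslash,/\rangle$ with a distinguished element $0$ such that ${\sim}a:=a\backslash 0$ and $-a:=0/a$ satisfy $-{\sim}a=a={\sim}{-}a$; it is regarded in the signature $\langle A,\wedge,\vee,\cdot,1,{\sim},-\rangle$. Concrete algebras: let $\langle X,\le\rangle$ be a poset, $E$ an equivalence relation on $X$ with ${\le}\subseteq E$, and $\alpha$ an order automorphism of $\langle X,\le\rangle$ with $\alpha\subseteq E$. Order $E$ by $(u,v)\preceq(x,y)$ iff $x\le u$ and $v\le y$. With $R^c=E\setminus R$, $R^\smile$ the converse and $\circ$ relational composition, $\mathfrak D(\mathbf E)=\langle \mathsf{Up}(\langle E,\preceq\rangle),\cap,\cup,\circ,\le,{\sim},-\rangle$, where ${\sim}R=R^{c\smile}\circ\alpha$, $-R=\alpha\circ R^{c\smile}$, is a DInFL-algebra. A DInFL-algebra is representable if it is isomorphic to a subalgebra of some $\mathfrak D(\mathbf E)$ of this form (equivalently it lies in $\mathbb{ISP}$ of those with $E=X^2$). *)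

theory Defs
  imports "HOL-Algebra.Group"
begin

section \<open>DInFL-algebras\<close>

text \<open>\<open>rneg\<close> is the operation usually written with a tilde, the left residual of \<open>0\<close> by
  its argument (\<open>a\<close> under \<open>0\<close>); \<open>lneg\<close> is the one written with a minus sign,
  \<open>-a = 0/a\<close>.\<close>

record 'a fl_algebra = "'a monoid" +
  wedge :: "['a, 'a] \<Rightarrow> 'a" (infixl \<open>\<curlywedge>\<index>\<close> 70)
  vee :: "['a, 'a] \<Rightarrow> 'a" (infixl \<open>\<curlyvee>\<index>\<close> 65)
  rneg :: "'a \<Rightarrow> 'a"
  lneg :: "'a \<Rightarrow> 'a"

definition fl_le :: "'a fl_algebra \<Rightarrow> 'a \<Rightarrow> 'a \<Rightarrow> bool" where
  "fl_le A a b \<longleftrightarrow> wedge A a b = a"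

text \<open>The residuals \<open>ld a c\<close> (\<open>a\<close> under \<open>c\<close>), \<open>rd c b\<close> (\<open>c\<close> over \<open>b\<close>) and the constant \<open>zero\<close> are not part of
  the signature; the residuals are uniquely determined by the order and the multiplication,
  and \<open>zero\<close> is necessarily \<open>rneg A \<one>\<close>.\<close>

locale dinfl = monoid A for A :: "'a fl_algebra" (structure) +
  assumes wedge_closed: "\<lbrakk>a \<in> carrier A; b \<in> carrier A\<rbrakk> \<Longrightarrow> a \<curlywedge> b \<in> carrier A"
    and vee_closed: "\<lbrakk>a \<in> carrier A; b \<in> carrier A\<rbrakk> \<Longrightarrow> a \<curlyvee> b \<in> carrier A"
    and rneg_closed: "a \<in> carrier A \<Longrightarrow> rneg A a \<in> carrier A"
    and lneg_closed: "a \<in> carrier A \<Longrightarrow> lneg A a \<in> carrier A"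
    and wedge_assoc: "\<lbrakk>a \<in> carrier A; b \<in> carrier A; c \<in> carrier A\<rbrakk>
      \<Longrightarrow> (a \<curlywedge> b) \<curlywedge> c = a \<curlywedge> (b \<curlywedge> c)"
    and vee_assoc: "\<lbrakk>a \<in> carrier A; b \<in> carrier A; c \<in> carrier A\<rbrakk>
      \<Longrightarrow> (a \<curlyvee> b) \<curlyvee> c = a \<curlyvee> (b \<curlyvee> c)"
    and wedge_comm: "\<lbrakk>a \<in> carrier A; b \<in> carrier A\<rbrakk> \<Longrightarrow> a \<curlywedge> b = b \<curlywedge> a"
    and vee_comm: "\<lbrakk>a \<in> carrier A; b \<in> carrier A\<rbrakk> \<Longrightarrow> a \<curlyvee> b = b \<curlyvee> a"
    and wedge_absorb: "\<lbrakk>a \<in> carrier A; b \<in> carrier A\<rbrakk> \<Longrightarrow> a \<curlywedge> (a \<curlyvee> b) = a"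
    and vee_absorb: "\<lbrakk>a \<in> carrier A; b \<in> carrier A\<rbrakk> \<Longrightarrow> a \<curlyvee> (a \<curlywedge> b) = a"
    and distrib: "\<lbrakk>a \<in> carrier A; b \<in> carrier A; c \<in> carrier A\<rbrakk>
      \<Longrightarrow> a \<curlywedge> (b \<curlyvee> c) = (a \<curlywedge> b) \<curlyvee> (a \<curlywedge> c)"
    and residuated_involutive: "\<exists>ld rd zero.
      zero \<in> carrier A \<and>
      (\<forall>a\<in>carrier A. \<forall>b\<in>carrier A. ld a b \<in> carrier A \<and> rd a b \<in> carrier A) \<and>
      (\<forall>a\<in>carrier A. \<forall>b\<in>carrier A. \<forall>c\<in>carrier A.
        (fl_le A (a \<otimes> b) c \<longleftrightarrow> fl_le A b (ld a c)) \<and>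
        (fl_le A (a \<otimes> b) c \<longleftrightarrow> fl_le A a (rd c b))) \<and>
      (\<forall>a\<in>carrier A. rneg A a = ld a zero \<and> lneg A a = rd zero a \<and>
        lneg A (rneg A a) = a \<and> rneg A (lneg A a) = a)"

definition fl_iso :: "'a fl_algebra \<Rightarrow> 'b fl_algebra \<Rightarrow> ('a \<Rightarrow> 'b) \<Rightarrow> bool" where
  "fl_iso A B h \<longleftrightarrow>
    bij_betw h (carrier A) (carrier B) \<and>
    (\<forall>a\<in>carrier A. \<forall>b\<in>carrier A.
      h (wedge A a b) = wedge B (h a) (h b) \<and>
      h (vee A a b) = vee B (h a) (h b) \<and>
      h (a \<otimes>\<^bsub>A\<^esub> b) = h a \<otimes>\<^bsub>B\<^esub> h b) \<and>
    h \<one>\<^bsub>A\<^esub> = \<one>\<^bsub>B\<^esub> \<and>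
    (\<forall>a\<in>carrier A. h (rneg A a) = rneg B (h a) \<and> h (lneg A a) = lneg B (h a))"

definition fl_isomorphic :: "'a fl_algebra \<Rightarrow> 'b fl_algebra \<Rightarrow> bool" where
  "fl_isomorphic A B \<longleftrightarrow> (\<exists>h. fl_iso A B h)"

definition fl_subuniverse :: "'a set \<Rightarrow> 'a fl_algebra \<Rightarrow> bool" where
  "fl_subuniverse S A \<longleftrightarrow>
    S \<subseteq> carrier A \<and> \<one>\<^bsub>A\<^esub> \<in> S \<and>
    (\<forall>a\<in>S. \<forall>b\<in>S. wedge A a b \<in> S \<and> vee A a b \<in> S \<and> a \<otimes>\<^bsub>A\<^esub> b \<in> S) \<and>
    (\<forall>a\<in>S. rneg A a \<in> S \<and> lneg A a \<in> S)"


section \<open>Concrete algebras and representability\<close>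

definition aut_graph :: "'x set \<Rightarrow> ('x \<Rightarrow> 'x) \<Rightarrow> 'x rel" where
  "aut_graph X \<alpha> = (\<lambda>x. (x, \<alpha> x)) ` X"

definition concrete_base :: "'x set \<Rightarrow> 'x rel \<Rightarrow> 'x rel \<Rightarrow> ('x \<Rightarrow> 'x) \<Rightarrow> bool" where
  "concrete_base X L E \<alpha> \<longleftrightarrow>
    partial_order_on X L \<and> equiv X E \<and> L \<subseteq> E \<and>
    bij_betw \<alpha> X X \<and> (\<forall>x\<in>X. \<forall>y\<in>X. (x, y) \<in> L \<longleftrightarrow> (\<alpha> x, \<alpha> y) \<in> L) \<and>
    aut_graph X \<alpha> \<subseteq> E"

definition pair_le :: "'x rel \<Rightarrow> 'x \<times> 'x \<Rightarrow> 'x \<times> 'x \<Rightarrow> bool" where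
  "pair_le L = (\<lambda>(u, v) (x, y). (x, u) \<in> L \<and> (v, y) \<in> L)"

definition up_sets :: "'x rel \<Rightarrow> 'x rel \<Rightarrow> 'x rel set" where
  "up_sets L E = {R. R \<subseteq> E \<and> (\<forall>p\<in>R. \<forall>q\<in>E. pair_le L p q \<longrightarrow> q \<in> R)}"

definition concrete_algebra :: "'x set \<Rightarrow> 'x rel \<Rightarrow> 'x rel \<Rightarrow> ('x \<Rightarrow> 'x) \<Rightarrow> 'x rel fl_algebra" where
  "concrete_algebra X L E \<alpha> =
    \<lparr>carrier = up_sets L E,
     mult = (\<lambda>R S. R O S),
     one = L,
     wedge = (\<lambda>R S. R \<inter> S),
     vee = (\<lambda>R S. R \<union> S),
     rneg = (\<lambda>R. (E - R)\<inverse> O aut_graph X \<alpha>),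
     lneg = (\<lambda>R. aut_graph X \<alpha> O (E - R)\<inverse>)\<rparr>"

text \<open>HOL cannot quantify existentially over types, so the class of representable algebras is
  relative to the type \<open>'x\<close> whose subsets serve as base posets. If \<open>'x\<close> is infinite and
  at least as large as the carrier, this is the full class, by the downward
  Loewenheim-Skolem theorem. An empty base poset is allowed; it represents the trivial algebra.\<close>

definition RDInFL :: "'x itself \<Rightarrow> 'a fl_algebra set" where
  "RDInFL _ = {A. dinfl A \<and>
    (\<exists>(X :: 'x set) L E \<alpha> S.
      concrete_base X L E \<alpha> \<and>
      fl_subuniverse S (concrete_algebra X L E \<alpha>) \<and>
      fl_isomorphic A ((concrete_algebra X L E \<alpha>)\<lparr>carrier := S\<rparr>))}"


section \<open>Ultraproducts\<close>

text \<open>An ultrafilter on the set \<open>I\<close>, as a filter on the ambient type that contains \<open>I\<close>.\<close>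

definition ultrafilter_on :: "'i set \<Rightarrow> 'i filter \<Rightarrow> bool" where
  "ultrafilter_on I F \<longleftrightarrow>
    F \<noteq> bot \<and> F \<le> principal I \<and>
    (\<forall>P. eventually P F \<or> eventually (\<lambda>i. \<not> P i) F)"

definition ultra_rel :: "'i set \<Rightarrow> 'i filter \<Rightarrow> ('i \<Rightarrow> 'a fl_algebra) \<Rightarrow> ('i \<Rightarrow> 'a) rel" where
  "ultra_rel I F A =
    {(f, g). f \<in> (\<Pi>\<^sub>E i\<in>I. carrier (A i)) \<and> g \<in> (\<Pi>\<^sub>E i\<in>I. carrier (A i)) \<and>
             eventually (\<lambda>i. f i = g i) F}"

definition ultraproduct ::
  "'i set \<Rightarrow> 'i filter \<Rightarrow> ('i \<Rightarrow> 'a fl_algebra) \<Rightarrow> ('i \<Rightarrow> 'a) set fl_algebra" where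
  "ultraproduct I F A =
    (let r = ultra_rel I F A;
         un = (\<lambda>op C. \<Union>f\<in>C. r `` {\<lambda>i\<in>I. op (A i) (f i)});
         bin = (\<lambda>op C D. \<Union>f\<in>C. \<Union>g\<in>D. r `` {\<lambda>i\<in>I. op (A i) (f i) (g i)})
     in \<lparr>carrier = (\<Pi>\<^sub>E i\<in>I. carrier (A i)) // r,
         mult = bin mult,
         one = r `` {\<lambda>i\<in>I. one (A i)},
         wedge = bin wedge,
         vee = bin vee,
         rneg = un rneg,
         lneg = un lneg\<rparr>)"

text \<open>As usual for class operators, ultraproducts are taken up to isomorphism; \<open>'i\<close> is the
  type from which the index sets are taken. The conjunct \<open>dinfl B\<close> ensures that the carrier of
  \<open>B\<close> is closed under the operations, which \<open>fl_isomorphic\<close> alone does not.\<close>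

definition ultraproducts :: "'i itself \<Rightarrow> 'a fl_algebra set \<Rightarrow> 'b fl_algebra set" where
  "ultraproducts _ K = {B. dinfl B \<and>
    (\<exists>(I :: 'i set) F A.
      ultrafilter_on I F \<and> (\<forall>i\<in>I. A i \<in> K) \<and> fl_isomorphic B (ultraproduct I F A))}"

end

theory Submission
  imports Defs
begin

text \<open>Representability is preserved because the ultraproduct of the algebras embeds into the concrete
  algebra over the ultraproduct of the base structures: lifting relations to germs commutes with
  intersection, composition and converse, and, by maximality of the filter, with union and relative
  complement, and it separates relations that differ almost everywhere. A subalgebra of a concrete
  algebra is itself a DInFL-algebra, with residuals a under c = ~(-c a) and c over b = -(b ~c), so
  closure under the operations is all that must be checked about the ultraproduct.

  To stay within a fixed type of base points, the base is cut down to a Skolem hull if the type is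
  infinite; over a finite type every germ is that of a constant function, so the ultraproduct of
  the bases already fits.\<close>

section \<open>Embeddings into concrete algebras\<close>

text \<open>Representability asserts that some base exists, so it is not transferred as a list of
  axioms. What passes to the ultraproduct is the two-sorted structure of an algebra together with a
  base on which its elements act as relations, one ultrafilter acting on both sorts. The lifted
  relations need not exhaust the concrete algebra over the lifted base; this is harmless, since an
  embedding suffices.

  Lifting turns base points of type \<open>'x\<close> into sets of functions, of type
  \<open>('i \<Rightarrow> 'x) set\<close>, whereas \<open>RDInFL\<close> depends on the type of the
  points. An equality of classes therefore needs a way back. When \<open>'u\<close> is infinite and
  serves both for elements and for points, there is room: composition witnesses are indexed by pairs
  of elements, and there are only as many pairs as elements. Over a finite type this cardinal
  arithmetic fails, and closing off under Skolem functions gives no bound, hence the separate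
  argument.\<close>

definition fl_embedding :: "'a fl_algebra \<Rightarrow> 'b fl_algebra \<Rightarrow> ('a \<Rightarrow> 'b) \<Rightarrow> bool" where
  "fl_embedding A B h \<longleftrightarrow>
    inj_on h (carrier A) \<and> h ` carrier A \<subseteq> carrier B \<and>
    (\<forall>a\<in>carrier A. \<forall>b\<in>carrier A.
      h (wedge A a b) = wedge B (h a) (h b) \<and>
      h (vee A a b) = vee B (h a) (h b) \<and>
      h (a \<otimes>\<^bsub>A\<^esub> b) = h a \<otimes>\<^bsub>B\<^esub> h b) \<and>
    h \<one>\<^bsub>A\<^esub> = \<one>\<^bsub>B\<^esub> \<and>
    (\<forall>a\<in>carrier A. h (rneg A a) = rneg B (h a) \<and> h (lneg A a) = lneg B (h a))"

lemma dinfl_closed: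
  assumes "dinfl A"
  shows "fl_subuniverse (carrier A) A"
proof -
  interpret dinfl A by fact
  show ?thesis
    by (simp add: fl_subuniverse_def wedge_closed vee_closed rneg_closed lneg_closed)
qed

lemma fl_iso_imp_embedding: "fl_iso A B h \<Longrightarrow> fl_embedding A B h"
  by (simp add: fl_iso_def fl_embedding_def bij_betw_def)

lemma fl_embedding_comp:
  assumes g: "fl_embedding A B g" and h: "fl_embedding B C h"
  shows "fl_embedding A C (h \<circ> g)"
proof -
  have "g a \<in> carrier B" if "a \<in> carrier A" for a
    using g that by (auto simp: fl_embedding_def)
  then show ?thesis
    using g h unfolding fl_embedding_def
    by (auto intro: comp_inj_on inj_on_subset)
qed

text \<open>\<open>fl_embedding\<close> constrains \<open>h\<close> on the carrier but does not
  force the operations to stay inside it, hence closure of \<open>carrier A\<close> as a separate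
  hypothesis.\<close>

lemma fl_embedding_image:
  assumes "fl_subuniverse (carrier A) A" and h: "fl_embedding A B h"
  shows "fl_subuniverse (h ` carrier A) B"
    and "fl_iso A (B\<lparr>carrier := h ` carrier A\<rparr>) h"
proof -
  have [simp]: "wedge A a b \<in> carrier A" "vee A a b \<in> carrier A" "a \<otimes>\<^bsub>A\<^esub> b \<in> carrier A"
    "rneg A a \<in> carrier A" "lneg A a \<in> carrier A" "\<one>\<^bsub>A\<^esub> \<in> carrier A"
    if "a \<in> carrier A" "b \<in> carrier A" for a b
    using assms(1) that by (auto simp: fl_subuniverse_def)
  have hom: "wedge B (h a) (h b) = h (wedge A a b)" "vee B (h a) (h b) = h (vee A a b)"
    "h a \<otimes>\<^bsub>B\<^esub> h b = h (a \<otimes>\<^bsub>A\<^esub> b)" "rneg B (h a) = h (rneg A a)" "lneg B (h a) = h (lneg A a)"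
    if "a \<in> carrier A" "b \<in> carrier A" for a b
    using h that by (auto simp: fl_embedding_def)
  have one: "\<one>\<^bsub>B\<^esub> = h \<one>\<^bsub>A\<^esub>" "\<one>\<^bsub>A\<^esub> \<in> carrier A"
    using h assms(1) by (auto simp: fl_embedding_def fl_subuniverse_def)
  have sub: "h ` carrier A \<subseteq> carrier B"
    using h by (simp add: fl_embedding_def)
  show "fl_subuniverse (h ` carrier A) B"
    using sub unfolding fl_subuniverse_def by (auto simp: hom one)
  show "fl_iso A (B\<lparr>carrier := h ` carrier A\<rparr>) h"
    using h by (simp add: fl_iso_def fl_embedding_def bij_betw_def)
qed

section \<open>Relational calculus with the twisted complement: double negation and
  residuation\<close>

locale concrete =
  fixes X :: "'x set" and L E :: "'x rel" and \<alpha> :: "'x \<Rightarrow> 'x"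
  assumes base: "concrete_base X L E \<alpha>"
begin

text \<open>Both negations are taken on all relations, since double negation and residuation rest
  only on inclusion in \<open>E\<close>; up-closure enters with the unit \<open>L\<close>.\<close>

definition "rn R = (E - R)\<inverse> O aut_graph X \<alpha>"
definition "ln R = aut_graph X \<alpha> O (E - R)\<inverse>"

lemma E_field: "(x, y) \<in> E \<Longrightarrow> x \<in> X \<and> y \<in> X"
  and E_refl: "x \<in> X \<Longrightarrow> (x, x) \<in> E"
  and E_sym: "(x, y) \<in> E \<Longrightarrow> (y, x) \<in> E"
  and E_trans: "(x, y) \<in> E \<Longrightarrow> (y, z) \<in> E \<Longrightarrow> (x, z) \<in> E"
  using base unfolding concrete_base_def equiv_def refl_on_def
  by (auto dest: symD transD)

lemma L_E: "L \<subseteq> E"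
  using base by (simp add: concrete_base_def)

lemma L_refl: "x \<in> X \<Longrightarrow> (x, x) \<in> L"
  and L_trans: "(x, y) \<in> L \<Longrightarrow> (y, z) \<in> L \<Longrightarrow> (x, z) \<in> L"
  and L_antisym: "(x, y) \<in> L \<Longrightarrow> (y, x) \<in> L \<Longrightarrow> x = y"
  using base unfolding concrete_base_def partial_order_on_def preorder_on_def refl_on_def
  by (auto dest: antisymD transD)

lemma aut_in: "x \<in> X \<Longrightarrow> \<alpha> x \<in> X"
  and aut_inj: "inj_on \<alpha> X"
  and aut_L: "x \<in> X \<Longrightarrow> y \<in> X \<Longrightarrow> (\<alpha> x, \<alpha> y) \<in> L \<longleftrightarrow> (x, y) \<in> L"
  and aut_E: "x \<in> X \<Longrightarrow> (x, \<alpha> x) \<in> E"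
  using base unfolding concrete_base_def bij_betw_def aut_graph_def by auto

lemma aut_surj:
  assumes "y \<in> X" obtains x where "x \<in> X" "y = \<alpha> x"
  using base assms unfolding concrete_base_def bij_betw_def by blast

lemma aut_E2:
  assumes "x \<in> X" "y \<in> X"
  shows "(\<alpha> x, y) \<in> E \<longleftrightarrow> (x, y) \<in> E" "(y, \<alpha> x) \<in> E \<longleftrightarrow> (y, x) \<in> E"
  by (meson assms aut_E E_sym E_trans)+

text \<open>Writing the target as \<open>\<alpha> y\<close> avoids the inverse of \<alpha>:
  injectivity identifies the middle point with \<open>y\<close>, and by \<open>aut_surj\<close>
  every target in \<open>X\<close> has this form.\<close>

lemma rn_iff: "y \<in> X \<Longrightarrow> (x, \<alpha> y) \<in> rn R \<longleftrightarrow> (y, x) \<in> E \<and> (y, x) \<notin> R"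
  using aut_inj E_field unfolding rn_def aut_graph_def inj_on_def by blast

lemma ln_iff: "(x, y) \<in> ln R \<longleftrightarrow> x \<in> X \<and> (y, \<alpha> x) \<in> E \<and> (y, \<alpha> x) \<notin> R"
  by (auto simp: ln_def aut_graph_def)

lemma rn_field: "(x, y) \<in> rn R \<Longrightarrow> x \<in> X \<and> y \<in> X"
  using aut_in E_field unfolding rn_def aut_graph_def by blast

text \<open>At a target \<open>\<alpha> z\<close> the two converses and the two uses of \<alpha>
  cancel; the two complements cancel because they are relative to \<open>E\<close> and
  \<open>R \<subseteq> E\<close>.\<close>

lemma rn_ln:
  assumes "R \<subseteq> E" shows "rn (ln R) = R"
proof -
  have "(x, y) \<in> rn (ln R) \<longleftrightarrow> (x, y) \<in> R" if "y \<in> X" for x y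
    using that
  proof (rule aut_surj)
    fix z assume z: "z \<in> X" "y = \<alpha> z"
    show ?thesis
      unfolding z(2) rn_iff[OF z(1)] ln_iff
      using z(1) assms aut_E2 E_sym E_field by blast
  qed
  moreover have "y \<in> X" if "(x, y) \<in> R" for x y
    using that assms E_field by blast
  ultimately show ?thesis
    using rn_field[of _ _ "ln R"] by (metis (no_types, lifting) equalityI subrelI)
qed

lemma ln_rn:
  assumes "R \<subseteq> E" shows "ln (rn R) = R"
proof -
  have "(x, y) \<in> ln (rn R) \<longleftrightarrow> (x, y) \<in> R" for x y
  proof (cases "x \<in> X")
    case True
    show ?thesis
      unfolding ln_iff rn_iff[OF True]
      using True assms aut_E2 E_sym E_field by blast
  next
    case False
    then show ?thesis using assms E_field by (auto simp: ln_iff)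
  qed
  then show ?thesis by auto
qed

text \<open>At the target \<open>\<alpha> z\<close> one side tests \<open>(z, x)\<close> and the
  other \<open>(\<alpha> z, \<alpha> x)\<close>, and \<alpha> preserves and reflects
  \<open>L\<close>. This lets one element serve as the constant 0 of both negations.\<close>

lemma rn_L_eq_ln_L: "rn L = ln L"
proof -
  have "(x, y) \<in> rn L \<longleftrightarrow> (x, y) \<in> ln L" if "x \<in> X" "y \<in> X" for x y
    using that(2)
  proof (rule aut_surj)
    fix z assume z: "z \<in> X" "y = \<alpha> z"
    show ?thesis
      unfolding z(2) rn_iff[OF z(1)] ln_iff
      using z that aut_E2 aut_L aut_in by blast
  qed
  moreover have "(x, y) \<in> ln L \<Longrightarrow> x \<in> X \<and> y \<in> X" for x y
    unfolding ln_iff using E_field by blast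
  ultimately show ?thesis
    using rn_field[of _ _ L] by (metis (no_types, lifting) equalityI subrelI)
qed

text \<open>Schroeder's rotation of a triangle: a path from \<open>x\<close> through
  \<open>w\<close> to \<open>y\<close> with \<open>(x, y)\<close> outside \<open>T\<close> is read
  from its edge in \<open>S\<close>. With \<open>y = \<alpha> z\<close>, the shift by \<alpha> in
  \<open>ln\<close> is undone by the one in \<open>rn\<close>.\<close>

lemma comp_subset_iff_left:
  assumes "R \<subseteq> E" "S \<subseteq> E" "T \<subseteq> E"
  shows "R O S \<subseteq> T \<longleftrightarrow> S \<subseteq> rn (ln T O R)"
proof
  assume *: "R O S \<subseteq> T"
  show "S \<subseteq> rn (ln T O R)"
  proof
    fix p assume "p \<in> S"
    then obtain x y where p: "p = (x, y)" "(x, y) \<in> S" by (cases p) auto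
    then have xy: "(x, y) \<in> E" "y \<in> X" using assms E_field by auto
    from xy(2) show "p \<in> rn (ln T O R)"
    proof (rule aut_surj)
      fix z assume z: "z \<in> X" "y = \<alpha> z"
      have "x \<in> X" using xy(1) E_field by blast
      then have "(x, z) \<in> E" using xy(1) aut_E2(2)[OF z(1)] unfolding z(2) by simp
      then have "(z, x) \<in> E" by (rule E_sym)
      moreover have "(z, x) \<notin> ln T O R"
        using * p z by (auto simp: ln_iff)
      ultimately show ?thesis
        unfolding p(1) z(2) rn_iff[OF z(1)] by simp
    qed
  qed
next
  assume *: "S \<subseteq> rn (ln T O R)"
  show "R O S \<subseteq> T"
  proof clarify
    fix x y w assume xy: "(x, w) \<in> R" "(w, y) \<in> S"
    then have "y \<in> X" using assms E_field by auto
    then show "(x, y) \<in> T"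
    proof (rule aut_surj)
      fix z assume z: "z \<in> X" "y = \<alpha> z"
      have "(w, \<alpha> z) \<in> rn (ln T O R)" using * xy z by auto
      then have "(z, w) \<notin> ln T O R" using rn_iff[OF z(1)] by blast
      then have "(z, x) \<notin> ln T" using xy by blast
      moreover have "(x, y) \<in> E" using xy assms E_trans by blast
      ultimately show ?thesis using z by (auto simp: ln_iff)
    qed
  qed
qed

text \<open>The same rotation, onto the edge in \<open>R\<close>: \<open>ln\<close> moves the source
  \<open>x\<close> to \<open>\<alpha> x\<close>, and \<open>rn T\<close> read at the target
  \<open>\<alpha> x\<close> returns to \<open>x\<close>.\<close>

lemma comp_subset_iff_right:
  assumes "R \<subseteq> E" "S \<subseteq> E" "T \<subseteq> E"
  shows "R O S \<subseteq> T \<longleftrightarrow> R \<subseteq> ln (S O rn T)"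
proof
  assume *: "R O S \<subseteq> T"
  show "R \<subseteq> ln (S O rn T)"
  proof clarify
    fix x y assume xy: "(x, y) \<in> R"
    then have xyE: "(x, y) \<in> E" "x \<in> X" using assms E_field by auto
    then have "(y, \<alpha> x) \<in> E" using aut_E2(2)[of x y] E_field E_sym by metis
    moreover have "(y, \<alpha> x) \<notin> S O rn T"
      using * xy rn_iff[OF xyE(2)] by blast
    ultimately show "(x, y) \<in> ln (S O rn T)" using xyE by (simp add: ln_iff)
  qed
next
  assume *: "R \<subseteq> ln (S O rn T)"
  show "R O S \<subseteq> T"
  proof clarify
    fix x y w assume xy: "(x, w) \<in> R" "(w, y) \<in> S"
    then have x: "x \<in> X" using assms E_field by auto
    have "(w, \<alpha> x) \<notin> S O rn T" using * xy ln_iff by blast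
    then have "(y, \<alpha> x) \<notin> rn T" using xy by blast
    moreover have "(x, y) \<in> E" using xy assms E_trans by blast
    ultimately show "(x, y) \<in> T" using rn_iff[OF x] by simp
  qed
qed

lemma up_sets_sub: "R \<in> up_sets L E \<Longrightarrow> R \<subseteq> E"
  by (simp add: up_sets_def)

text \<open>An up-set absorbs \<open>L\<close> on either side, because
  \<open>L \<subseteq> E\<close> keeps the composed pair inside \<open>E\<close>; reflexivity of
  \<open>L\<close> gives the other inclusion. This makes \<open>L\<close> the unit.\<close>

lemma up_sets_O_L:
  assumes "R \<in> up_sets L E" shows "R O L = R" "L O R = R"
proof -
  have R: "R \<subseteq> E" using assms by (rule up_sets_sub)
  have up: "(x', y') \<in> R" if "(x, y) \<in> R" "(x', x) \<in> L" "(y, y') \<in> L" for x y x' y'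
  proof -
    have "(x', y') \<in> E" using that R L_E E_trans by blast
    then show ?thesis
      using assms that unfolding up_sets_def pair_le_def by blast
  qed
  have fld: "x \<in> X" "y \<in> X" if "(x, y) \<in> R" for x y
    using that R E_field by auto
  show "R O L = R"
  proof (intro equalityI subrelI)
    fix x y assume "(x, y) \<in> R O L"
    then show "(x, y) \<in> R" using up[of _ _ x] fld L_refl by blast
  next
    fix x y assume "(x, y) \<in> R"
    then show "(x, y) \<in> R O L" using fld(2) L_refl by blast
  qed
  show "L O R = R"
  proof (intro equalityI subrelI)
    fix x y assume "(x, y) \<in> L O R"
    then show "(x, y) \<in> R" using up[of _ y _ y] fld(2) L_refl by blast
  next
    fix x y assume "(x, y) \<in> R"
    then show "(x, y) \<in> L O R" using fld(1) L_refl by blast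
  qed
qed

lemma concrete_simps:
  "carrier (concrete_algebra X L E \<alpha>) = up_sets L E"
  "mult (concrete_algebra X L E \<alpha>) R S = R O S"
  "one (concrete_algebra X L E \<alpha>) = L"
  "wedge (concrete_algebra X L E \<alpha>) R S = R \<inter> S"
  "vee (concrete_algebra X L E \<alpha>) R S = R \<union> S"
  "rneg (concrete_algebra X L E \<alpha>) R = rn R"
  "lneg (concrete_algebra X L E \<alpha>) R = ln R"
  by (simp_all add: concrete_algebra_def rn_def ln_def)

text \<open>Each axiom becomes a fact about relations, with the order turned into inclusion, and
  returns along the injective \<open>h\<close>. The residuals stay in the carrier because they are
  terms in the signature.\<close>

lemma embedding_imp_dinfl:
  assumes closed: "fl_subuniverse (carrier A) A"
    and emb: "fl_embedding A (concrete_algebra X L E \<alpha>) h"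
  shows "dinfl A"
proof -
  have cl: "wedge A a b \<in> carrier A" "vee A a b \<in> carrier A" "a \<otimes>\<^bsub>A\<^esub> b \<in> carrier A"
    if "a \<in> carrier A" "b \<in> carrier A" for a b
    using closed that by (auto simp: fl_subuniverse_def)
  have cl1: "rneg A a \<in> carrier A" "lneg A a \<in> carrier A" if "a \<in> carrier A" for a
    using closed that by (auto simp: fl_subuniverse_def)
  have one: "\<one>\<^bsub>A\<^esub> \<in> carrier A" using closed by (simp add: fl_subuniverse_def)
  have hom: "h (wedge A a b) = h a \<inter> h b" "h (vee A a b) = h a \<union> h b"
    "h (a \<otimes>\<^bsub>A\<^esub> b) = h a O h b"
    if "a \<in> carrier A" "b \<in> carrier A" for a b
    using emb that by (auto simp: fl_embedding_def concrete_simps)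
  have hom1: "h (rneg A a) = rn (h a)" "h (lneg A a) = ln (h a)" if "a \<in> carrier A" for a
    using emb that by (auto simp: fl_embedding_def concrete_simps)
  have h1: "h \<one>\<^bsub>A\<^esub> = L" using emb by (simp add: fl_embedding_def concrete_simps)
  have up: "h a \<in> up_sets L E" if "a \<in> carrier A" for a
    using emb that by (auto simp: fl_embedding_def concrete_simps)
  note sub = up_sets_sub[OF up]
  have eqI: "a = b" if "h a = h b" "a \<in> carrier A" "b \<in> carrier A" for a b
    using emb that by (auto simp: fl_embedding_def inj_on_def)
  have le: "fl_le A a b \<longleftrightarrow> h a \<subseteq> h b" if "a \<in> carrier A" "b \<in> carrier A" for a b
  proof -
    have "fl_le A a b \<longleftrightarrow> h (wedge A a b) = h a"
      unfolding fl_le_def using that eqI cl by metis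
    then show ?thesis using that hom by auto
  qed
  note closures = cl cl1 one
  note homs = hom hom1 h1
  have ll: "lneg A (rneg A a) = a" "rneg A (lneg A a) = a" if "a \<in> carrier A" for a
    using that by (auto intro!: eqI simp: closures homs ln_rn rn_ln sub)
  have neg_one: "rneg A \<one>\<^bsub>A\<^esub> = lneg A \<one>\<^bsub>A\<^esub>"
    by (rule eqI) (simp_all add: closures homs rn_L_eq_ln_L)
  have monoid: "monoid A"
    by unfold_locales
      (auto intro!: eqI simp: closures homs up_sets_O_L[OF up] O_assoc)
  show ?thesis
  proof (intro dinfl.intro monoid dinfl_axioms.intro)
    let ?ld = "\<lambda>a c. rneg A (lneg A c \<otimes>\<^bsub>A\<^esub> a)"
    let ?rd = "\<lambda>c b. lneg A (b \<otimes>\<^bsub>A\<^esub> rneg A c)"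
    let ?z = "rneg A \<one>\<^bsub>A\<^esub>"
    have res: "fl_le A (a \<otimes>\<^bsub>A\<^esub> b) c \<longleftrightarrow> fl_le A b (?ld a c)"
      "fl_le A (a \<otimes>\<^bsub>A\<^esub> b) c \<longleftrightarrow> fl_le A a (?rd c b)"
      if "a \<in> carrier A" "b \<in> carrier A" "c \<in> carrier A" for a b c
      using that comp_subset_iff_left[OF sub sub sub, of a b c]
        comp_subset_iff_right[OF sub sub sub, of a b c]
      by (simp_all add: le closures homs)
    \<comment> \<open>With 0 = ~1, the term for \<open>a\<close> under 0 is ~(-~1 a) = ~a. For 0
      over \<open>a\<close> the description 0 = -1 is the one that cancels, which is the purpose of
      \<open>neg_one\<close>.\<close>
    have neg: "rneg A a = ?ld a ?z" "lneg A a = ?rd ?z a" if "a \<in> carrier A" for a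
      using that monoid
      by (simp_all add: ll one monoid.l_one monoid.r_one) (simp add: neg_one ll one monoid.r_one)
    show "\<exists>ld rd zero. zero \<in> carrier A \<and>
      (\<forall>a\<in>carrier A. \<forall>b\<in>carrier A. ld a b \<in> carrier A \<and> rd a b \<in> carrier A) \<and>
      (\<forall>a\<in>carrier A. \<forall>b\<in>carrier A. \<forall>c\<in>carrier A.
        (fl_le A (a \<otimes>\<^bsub>A\<^esub> b) c \<longleftrightarrow> fl_le A b (ld a c)) \<and>
        (fl_le A (a \<otimes>\<^bsub>A\<^esub> b) c \<longleftrightarrow> fl_le A a (rd c b))) \<and>
      (\<forall>a\<in>carrier A. rneg A a = ld a zero \<and> lneg A a = rd zero a \<and>
        lneg A (rneg A a) = a \<and> rneg A (lneg A a) = a)"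
    proof (rule exI[of _ ?ld], rule exI[of _ ?rd], rule exI[of _ ?z], intro conjI ballI)
      fix a b c assume abc: "a \<in> carrier A" "b \<in> carrier A" "c \<in> carrier A"
      show "fl_le A (a \<otimes>\<^bsub>A\<^esub> b) c = fl_le A b (?ld a c)"
        "fl_le A (a \<otimes>\<^bsub>A\<^esub> b) c = fl_le A a (?rd c b)"
        using res abc by blast+
    next
      fix a assume a: "a \<in> carrier A"
      show "rneg A a = ?ld a ?z" "lneg A a = ?rd ?z a"
        using neg[OF a] .
    qed (simp_all add: closures ll)
  qed (auto intro!: eqI simp: closures homs)
qed

end

text \<open>An embedding already yields the axioms of \<open>dinfl\<close>, so only closure survives
  from them, and the subuniverse \<open>S\<close> is absorbed as the image of \<open>h\<close>. In
  this form representability is transported by composing embeddings.\<close>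

lemma RDInFL_iff:
  "A \<in> RDInFL TYPE('x) \<longleftrightarrow> fl_subuniverse (carrier A) A \<and>
    (\<exists>(X :: 'x set) L E \<alpha> h.
      concrete_base X L E \<alpha> \<and> fl_embedding A (concrete_algebra X L E \<alpha>) h)"
    (is "?lhs \<longleftrightarrow> ?rhs")
proof
  assume ?lhs
  then obtain X :: "'x set" and L E \<alpha> S h where
    *: "dinfl A" "concrete_base X L E \<alpha>"
    "fl_subuniverse S (concrete_algebra X L E \<alpha>)"
    "fl_iso A ((concrete_algebra X L E \<alpha>)\<lparr>carrier := S\<rparr>) h"
    unfolding RDInFL_def fl_isomorphic_def by blast
  have "fl_embedding A (concrete_algebra X L E \<alpha>) h"
    using *(3) fl_iso_imp_embedding[OF *(4)]
    by (auto simp: fl_embedding_def fl_subuniverse_def)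
  with *(2) have "concrete_base X L E \<alpha> \<and> fl_embedding A (concrete_algebra X L E \<alpha>) h"
    by simp
  then have "\<exists>(X :: 'x set) L E \<alpha> h.
      concrete_base X L E \<alpha> \<and> fl_embedding A (concrete_algebra X L E \<alpha>) h"
    by - ((rule exI)+, assumption)
  with dinfl_closed[OF *(1)] show ?rhs by simp
next
  assume ?rhs
  then obtain X :: "'x set" and L E \<alpha> h where
    *: "fl_subuniverse (carrier A) A" "concrete_base X L E \<alpha>"
    "fl_embedding A (concrete_algebra X L E \<alpha>) h" by blast
  interpret concrete X L E \<alpha> by unfold_locales fact
  have "fl_isomorphic A ((concrete_algebra X L E \<alpha>)\<lparr>carrier := h ` carrier A\<rparr>)"
    unfolding fl_isomorphic_def using fl_embedding_image(2)[OF *(1,3)] by blast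
  then have "concrete_base X L E \<alpha> \<and>
      fl_subuniverse (h ` carrier A) (concrete_algebra X L E \<alpha>) \<and>
      fl_isomorphic A ((concrete_algebra X L E \<alpha>)\<lparr>carrier := h ` carrier A\<rparr>)"
    using *(2) fl_embedding_image(1)[OF *(1,3)] by simp
  then have "\<exists>(X :: 'x set) L E \<alpha> S. concrete_base X L E \<alpha> \<and>
      fl_subuniverse S (concrete_algebra X L E \<alpha>) \<and>
      fl_isomorphic A ((concrete_algebra X L E \<alpha>)\<lparr>carrier := S\<rparr>)"
    by - ((rule exI)+, assumption)
  with embedding_imp_dinfl[OF *(1,3)] show ?lhs
    unfolding RDInFL_def by simp
qed

section \<open>Ultraproducts of concrete algebras\<close>

text \<open>Germs are taken of functions on the whole index type, with membership in the base posets
  required only almost everywhere, because some of the base posets may be empty.\<close>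

definition germ :: "'i filter \<Rightarrow> ('i \<Rightarrow> 'x) \<Rightarrow> ('i \<Rightarrow> 'x) set" where
  "germ F x = {y. eventually (\<lambda>i. x i = y i) F}"

definition germ_set :: "'i filter \<Rightarrow> ('i \<Rightarrow> 'x set) \<Rightarrow> ('i \<Rightarrow> 'x) set set" where
  "germ_set F X = {germ F x | x. eventually (\<lambda>i. x i \<in> X i) F}"

definition germ_rel :: "'i filter \<Rightarrow> ('i \<Rightarrow> 'x rel) \<Rightarrow> ('i \<Rightarrow> 'x) set rel" where
  "germ_rel F R = {(germ F x, germ F y) | x y. eventually (\<lambda>i. (x i, y i) \<in> R i) F}"

text \<open>The inverse of \<open>germ F\<close> picks some representative;
  \<open>germ_map_germ\<close> shows that the choice is immaterial.\<close>

definition germ_map :: "'i filter \<Rightarrow> ('i \<Rightarrow> 'x \<Rightarrow> 'x) \<Rightarrow> ('i \<Rightarrow> 'x) set \<Rightarrow> ('i \<Rightarrow> 'x) set" where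
  "germ_map F \<alpha> p = germ F (\<lambda>i. \<alpha> i (inv_into UNIV (germ F) p i))"

lemma germ_eq_iff: "germ F x = germ F y \<longleftrightarrow> eventually (\<lambda>i. x i = y i) F"
proof
  assume "germ F x = germ F y"
  then have "y \<in> germ F x" by (simp add: germ_def)
  then show "eventually (\<lambda>i. x i = y i) F" by (simp add: germ_def)
next
  assume *: "eventually (\<lambda>i. x i = y i) F"
  have "eventually (\<lambda>i. x i = z i) F \<longleftrightarrow> eventually (\<lambda>i. y i = z i) F" for z
    by (rule eventually_subst, use * in eventually_elim) simp
  then show "germ F x = germ F y" by (simp add: germ_def)
qed

lemma germ_in_germ_set: "germ F x \<in> germ_set F X \<longleftrightarrow> eventually (\<lambda>i. x i \<in> X i) F"
proof
  assume "germ F x \<in> germ_set F X"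
  then obtain y where "eventually (\<lambda>i. x i = y i) F" "eventually (\<lambda>i. y i \<in> X i) F"
    by (auto simp: germ_set_def germ_eq_iff)
  then show "eventually (\<lambda>i. x i \<in> X i) F" by eventually_elim simp
qed (auto simp: germ_set_def)

text \<open>The atomic case of Los's theorem: finitely many almost-everywhere statements hold
  jointly almost everywhere, so any representatives may be used.\<close>

lemma germ_in_germ_rel: "(germ F x, germ F y) \<in> germ_rel F R \<longleftrightarrow> eventually (\<lambda>i. (x i, y i) \<in> R i) F"
proof
  assume "(germ F x, germ F y) \<in> germ_rel F R"
  then obtain x' y' where "eventually (\<lambda>i. x i = x' i) F" "eventually (\<lambda>i. y i = y' i) F"
    "eventually (\<lambda>i. (x' i, y' i) \<in> R i) F"
    by (auto simp: germ_rel_def germ_eq_iff)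
  then show "eventually (\<lambda>i. (x i, y i) \<in> R i) F" by eventually_elim simp
qed (auto simp: germ_rel_def)

lemma germ_relE:
  assumes "(p, q) \<in> germ_rel F R"
  obtains x y where "p = germ F x" "q = germ F y"
  using assms by (auto simp: germ_rel_def)

lemma germ_setE:
  assumes "p \<in> germ_set F X"
  obtains x where "p = germ F x" "eventually (\<lambda>i. x i \<in> X i) F"
  using assms by (auto simp: germ_set_def)

lemma germ_map_germ: "germ_map F \<alpha> (germ F x) = germ F (\<lambda>i. \<alpha> i (x i))"
proof -
  have "germ F (inv_into UNIV (germ F) (germ F x)) = germ F x"
    using f_inv_into_f[of "germ F x" "germ F" UNIV] by simp
  then have "eventually (\<lambda>i. inv_into UNIV (germ F) (germ F x) i = x i) F" by (simp add: germ_eq_iff)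
  then show ?thesis unfolding germ_map_def germ_eq_iff by eventually_elim simp
qed

lemma germ_rel_cong: "eventually (\<lambda>i. R i = S i) F \<Longrightarrow> germ_rel F R = germ_rel F S"
proof -
  assume *: "eventually (\<lambda>i. R i = S i) F"
  have "eventually (\<lambda>i. p i \<in> R i) F \<longleftrightarrow> eventually (\<lambda>i. p i \<in> S i) F" for p
    by (rule eventually_subst, use * in eventually_elim) simp
  then show ?thesis unfolding germ_rel_def by simp
qed

lemma germ_rel_subsetI:
  assumes "\<And>x y. eventually (\<lambda>i. (x i, y i) \<in> R i) F \<Longrightarrow> (germ F x, germ F y) \<in> S"
  shows "germ_rel F R \<subseteq> S"
  using assms by (auto simp: germ_rel_def)

lemma germ_rel_mono: "eventually (\<lambda>i. R i \<subseteq> S i) F \<Longrightarrow> germ_rel F R \<subseteq> germ_rel F S"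
  by (rule germ_rel_subsetI, unfold germ_in_germ_rel) (erule (1) eventually_elim2, blast)

lemma germ_rel_Int: "germ_rel F (\<lambda>i. R i \<inter> S i) = germ_rel F R \<inter> germ_rel F S"
proof
  show "germ_rel F R \<inter> germ_rel F S \<subseteq> germ_rel F (\<lambda>i. R i \<inter> S i)"
  proof
    fix p assume p: "p \<in> germ_rel F R \<inter> germ_rel F S"
    then obtain x y where "p = (germ F x, germ F y)" by (auto simp: germ_rel_def)
    then show "p \<in> germ_rel F (\<lambda>i. R i \<inter> S i)"
      using p by (simp add: germ_in_germ_rel eventually_conj_iff)
  qed
qed (intro Int_greatest germ_rel_mono; simp)

lemma germ_rel_converse: "germ_rel F (\<lambda>i. (R i)\<inverse>) = (germ_rel F R)\<inverse>"
  by (auto simp: germ_rel_def)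

text \<open>The existential case of Los's theorem, valid over any filter: middle points are chosen
  index by index and assembled into one function, whose values on a negligible set of indices are
  arbitrary.\<close>

lemma germ_rel_relcomp: "germ_rel F (\<lambda>i. R i O S i) = germ_rel F R O germ_rel F S"
proof
  show "germ_rel F (\<lambda>i. R i O S i) \<subseteq> germ_rel F R O germ_rel F S"
  proof (rule germ_rel_subsetI)
    fix x y assume *: "eventually (\<lambda>i. (x i, y i) \<in> R i O S i) F"
    define z where "z i = (SOME z. (x i, z) \<in> R i \<and> (z, y i) \<in> S i)" for i
    have "eventually (\<lambda>i. (x i, z i) \<in> R i \<and> (z i, y i) \<in> S i) F"
      using *
    proof eventually_elim
      case (elim i)
      then have "\<exists>z. (x i, z) \<in> R i \<and> (z, y i) \<in> S i" by blast
      then show ?case unfolding z_def by (rule someI_ex)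
    qed
    then have "(germ F x, germ F z) \<in> germ_rel F R" "(germ F z, germ F y) \<in> germ_rel F S"
      by (simp_all add: germ_in_germ_rel eventually_conj_iff)
    then show "(germ F x, germ F y) \<in> germ_rel F R O germ_rel F S" by blast
  qed
next
  show "germ_rel F R O germ_rel F S \<subseteq> germ_rel F (\<lambda>i. R i O S i)"
  proof
    fix p assume "p \<in> germ_rel F R O germ_rel F S"
    then obtain a b c where p: "p = (a, c)" "(a, b) \<in> germ_rel F R" "(b, c) \<in> germ_rel F S"
      by auto
    then obtain x y z where "a = germ F x" "b = germ F y" "c = germ F z"
      by (metis germ_relE)
    with p have "eventually (\<lambda>i. (x i, y i) \<in> R i) F" "eventually (\<lambda>i. (y i, z i) \<in> S i) F"
      by (simp_all add: germ_in_germ_rel)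
    then have "eventually (\<lambda>i. (x i, z i) \<in> R i O S i) F" by eventually_elim auto
    then show "p \<in> germ_rel F (\<lambda>i. R i O S i)"
      by (simp add: p(1) \<open>a = _\<close> \<open>c = _\<close> germ_in_germ_rel)
  qed
qed

text \<open>Both negations are compositions with this graph, so lifting it as a relation brings them
  under the lifting of composition.\<close>

lemma germ_rel_aut_graph:
  "germ_rel F (\<lambda>i. aut_graph (X i) (\<alpha> i)) = aut_graph (germ_set F X) (germ_map F \<alpha>)"
proof
  show "germ_rel F (\<lambda>i. aut_graph (X i) (\<alpha> i)) \<subseteq> aut_graph (germ_set F X) (germ_map F \<alpha>)"
  proof (rule germ_rel_subsetI)
    fix x y assume *: "eventually (\<lambda>i. (x i, y i) \<in> aut_graph (X i) (\<alpha> i)) F"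
    then have "eventually (\<lambda>i. x i \<in> X i) F" "eventually (\<lambda>i. y i = \<alpha> i (x i)) F"
      by (auto elim!: eventually_mono simp: aut_graph_def)
    then show "(germ F x, germ F y) \<in> aut_graph (germ_set F X) (germ_map F \<alpha>)"
      by (simp add: aut_graph_def image_iff germ_in_germ_set germ_map_germ germ_eq_iff)
  qed
next
  show "aut_graph (germ_set F X) (germ_map F \<alpha>) \<subseteq> germ_rel F (\<lambda>i. aut_graph (X i) (\<alpha> i))"
    by (auto simp: aut_graph_def germ_set_def germ_map_germ germ_in_germ_rel elim!: eventually_mono)
qed

section \<open>Lifting over an ultrafilter: union, complement, separation and the base
  axioms\<close>

locale ultrafilter =
  fixes F :: "'i filter"
  assumes proper: "F \<noteq> bot"
    and ultra: "eventually P F \<or> eventually (\<lambda>i. \<not> P i) F"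
begin

lemma not_eventually_iff: "\<not> eventually P F \<longleftrightarrow> eventually (\<lambda>i. \<not> P i) F"
proof
  assume "eventually (\<lambda>i. \<not> P i) F"
  then show "\<not> eventually P F"
    using proper eventually_conj[of P F "\<lambda>i. \<not> P i"] by auto
qed (use ultra in blast)

lemma eventually_disj: "eventually (\<lambda>i. P i \<or> Q i) F \<longleftrightarrow> eventually P F \<or> eventually Q F"
  using not_eventually_iff[of "\<lambda>i. P i \<or> Q i"] not_eventually_iff[of P] not_eventually_iff[of Q]
  by (auto simp: eventually_conj_iff)

lemma germ_rel_Un: "germ_rel F (\<lambda>i. R i \<union> S i) = germ_rel F R \<union> germ_rel F S"
  unfolding germ_rel_def by (auto simp: eventually_disj)

lemma germ_rel_Diff: "germ_rel F (\<lambda>i. R i - S i) = germ_rel F R - germ_rel F S"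
proof
  show "germ_rel F (\<lambda>i. R i - S i) \<subseteq> germ_rel F R - germ_rel F S"
    by (rule germ_rel_subsetI)
      (simp add: germ_in_germ_rel not_eventually_iff eventually_conj_iff)
  show "germ_rel F R - germ_rel F S \<subseteq> germ_rel F (\<lambda>i. R i - S i)"
  proof
    fix p assume p: "p \<in> germ_rel F R - germ_rel F S"
    then obtain x y where "p = (germ F x, germ F y)" by (auto simp: germ_rel_def)
    then show "p \<in> germ_rel F (\<lambda>i. R i - S i)"
      using p by (simp add: germ_in_germ_rel eventually_conj_iff not_eventually_iff)
  qed
qed

text \<open>If inclusion does not hold almost everywhere, then by maximality it fails almost
  everywhere; offending pairs chosen at those indices have a germ in the lifted difference. The
  resulting equality test makes the embedding of the ultraproduct injective.\<close>

lemma germ_rel_subset_iff: "germ_rel F R \<subseteq> germ_rel F S \<longleftrightarrow> eventually (\<lambda>i. R i \<subseteq> S i) F"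
proof
  assume *: "germ_rel F R \<subseteq> germ_rel F S"
  show "eventually (\<lambda>i. R i \<subseteq> S i) F"
  proof (rule ccontr)
    assume "\<not> eventually (\<lambda>i. R i \<subseteq> S i) F"
    then have ne: "eventually (\<lambda>i. \<not> R i \<subseteq> S i) F" by (simp add: not_eventually_iff)
    define p where "p i = (SOME p. p \<in> R i - S i)" for i
    have p: "eventually (\<lambda>i. p i \<in> R i - S i) F"
      using ne
    proof eventually_elim
      case (elim i)
      then have "\<exists>p. p \<in> R i - S i" by auto
      then show ?case unfolding p_def by (rule someI_ex)
    qed
    have "(germ F (\<lambda>i. fst (p i)), germ F (\<lambda>i. snd (p i))) \<in> germ_rel F (\<lambda>i. R i - S i)"
      using p by (simp add: germ_in_germ_rel)
    then show False using * unfolding germ_rel_Diff by blast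
  qed
qed (rule germ_rel_mono)

lemma germ_rel_eq_iff: "germ_rel F R = germ_rel F S \<longleftrightarrow> eventually (\<lambda>i. R i = S i) F"
  unfolding set_eq_subset germ_rel_subset_iff eventually_conj_iff by simp

text \<open>Transitivity and symmetry are phrased as inclusions such as
  \<open>L O L \<subseteq> L\<close>, which lift by monotonicity; reflexivity, antisymmetry and most
  automorphism conditions are argued on representatives.\<close>

lemma concrete_base_germ:
  assumes ev: "eventually (\<lambda>i. concrete_base (X i) (L i) (E i) (\<alpha> i)) F"
  shows "concrete_base (germ_set F X) (germ_rel F L) (germ_rel F E) (germ_map F \<alpha>)"
proof -
  let ?X = "germ_set F X" and ?L = "germ_rel F L" and ?E = "germ_rel F E" and ?a = "germ_map F \<alpha>"
  have conc: "eventually (\<lambda>i. concrete (X i) (L i) (E i) (\<alpha> i)) F"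
    using ev by (simp add: concrete_def)
  have field: "?E \<subseteq> ?X \<times> ?X"
  proof (rule germ_rel_subsetI)
    fix x y assume "eventually (\<lambda>i. (x i, y i) \<in> E i) F"
    with conc have "eventually (\<lambda>i. x i \<in> X i \<and> y i \<in> X i) F"
      by eventually_elim (rule concrete.E_field)
    then show "(germ F x, germ F y) \<in> ?X \<times> ?X"
      by (simp add: germ_in_germ_set eventually_conj_iff)
  qed
  have LE: "?L \<subseteq> ?E"
    by (rule germ_rel_mono, use conc in eventually_elim) (rule concrete.L_E)
  have graph: "aut_graph ?X ?a \<subseteq> ?E"
    unfolding germ_rel_aut_graph[symmetric]
    by (rule germ_rel_mono, use conc in eventually_elim)
      (auto simp: aut_graph_def dest: concrete.aut_E)
  have refl: "(p, p) \<in> ?L" if "p \<in> ?X" for p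
    using that
  proof (rule germ_setE)
    fix x assume x: "p = germ F x" "eventually (\<lambda>i. x i \<in> X i) F"
    from conc x(2) have "eventually (\<lambda>i. (x i, x i) \<in> L i) F"
      by eventually_elim (rule concrete.L_refl)
    then show ?thesis by (simp add: x(1) germ_in_germ_rel)
  qed
  have tr: "trans ?L"
  proof -
    have "?L O ?L \<subseteq> ?L"
      unfolding germ_rel_relcomp[symmetric]
      by (rule germ_rel_mono, use conc in eventually_elim) (auto dest: concrete.L_trans)
    then show ?thesis by (auto simp: trans_def)
  qed
  have trE: "trans ?E"
  proof -
    have "?E O ?E \<subseteq> ?E"
      unfolding germ_rel_relcomp[symmetric]
      by (rule germ_rel_mono, use conc in eventually_elim) (auto dest: concrete.E_trans)
    then show ?thesis by (auto simp: trans_def)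
  qed
  have symE: "sym ?E"
  proof -
    have "?E\<inverse> \<subseteq> ?E"
      unfolding germ_rel_converse[symmetric]
      by (rule germ_rel_mono, use conc in eventually_elim) (auto dest: concrete.E_sym)
    then show ?thesis by (auto simp: sym_def)
  qed
  have anti: "p = q" if "(p, q) \<in> ?L" "(q, p) \<in> ?L" for p q
    using that(1)
  proof (rule germ_relE)
    fix x y assume xy: "p = germ F x" "q = germ F y"
    have "eventually (\<lambda>i. (x i, y i) \<in> L i) F" "eventually (\<lambda>i. (y i, x i) \<in> L i) F"
      using that xy by (simp_all add: germ_in_germ_rel)
    with conc show "p = q"
      unfolding xy germ_eq_iff by eventually_elim (rule concrete.L_antisym)
  qed
  have inj: "inj_on ?a ?X"
  proof (rule inj_onI)
    fix p q assume p: "p \<in> ?X" and q: "q \<in> ?X" and eq: "?a p = ?a q"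
    obtain x where x: "p = germ F x" "eventually (\<lambda>i. x i \<in> X i) F"
      using p by (rule germ_setE)
    obtain y where y: "q = germ F y" "eventually (\<lambda>i. y i \<in> X i) F"
      using q by (rule germ_setE)
    have "eventually (\<lambda>i. \<alpha> i (x i) = \<alpha> i (y i)) F"
      using eq by (simp add: x(1) y(1) germ_map_germ germ_eq_iff)
    with conc x(2) y(2) show "p = q"
      unfolding x(1) y(1) germ_eq_iff
      by eventually_elim (erule inj_onD[OF concrete.aut_inj])
  qed
  have surj: "?a ` ?X = ?X"
  proof (rule equalityI; rule subsetI)
    fix q assume "q \<in> ?a ` ?X"
    then obtain x where x: "q = ?a (germ F x)" "eventually (\<lambda>i. x i \<in> X i) F"
      by (auto elim: germ_setE)
    from conc x(2) have "eventually (\<lambda>i. \<alpha> i (x i) \<in> X i) F"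
      by eventually_elim (rule concrete.aut_in)
    then show "q \<in> ?X" by (simp add: x(1) germ_map_germ germ_in_germ_set)
  next
    fix q assume "q \<in> ?X"
    then obtain y where y: "q = germ F y" "eventually (\<lambda>i. y i \<in> X i) F"
      by (auto elim: germ_setE)
    \<comment> \<open>A preimage is chosen at each index; outside the large set where
      \<open>\<alpha> i\<close> maps onto \<open>X i\<close> and \<open>y i\<close> lies in
      \<open>X i\<close>, its value is immaterial.\<close>
    define x where "x i = inv_into (X i) (\<alpha> i) (y i)" for i
    from ev y(2) have "eventually (\<lambda>i. x i \<in> X i \<and> \<alpha> i (x i) = y i) F"
      by eventually_elim
        (auto simp: x_def concrete_base_def bij_betw_def intro: f_inv_into_f inv_into_into)
    then have "germ F x \<in> ?X" "?a (germ F x) = q"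
      by (simp_all add: y(1) germ_map_germ germ_in_germ_set germ_eq_iff eventually_conj_iff)
    then show "q \<in> ?a ` ?X" by blast
  qed
  have mono: "(p, q) \<in> ?L \<longleftrightarrow> (?a p, ?a q) \<in> ?L" if "p \<in> ?X" "q \<in> ?X" for p q
  proof -
    obtain x where x: "p = germ F x" "eventually (\<lambda>i. x i \<in> X i) F"
      using \<open>p \<in> ?X\<close> by (rule germ_setE)
    obtain y where y: "q = germ F y" "eventually (\<lambda>i. y i \<in> X i) F"
      using \<open>q \<in> ?X\<close> by (rule germ_setE)
    from conc x(2) y(2)
    have "eventually (\<lambda>i. (\<alpha> i (x i), \<alpha> i (y i)) \<in> L i \<longleftrightarrow> (x i, y i) \<in> L i) F"
      by eventually_elim (rule concrete.aut_L)
    then have "eventually (\<lambda>i. (x i, y i) \<in> L i) F \<longleftrightarrow>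
        eventually (\<lambda>i. (\<alpha> i (x i), \<alpha> i (y i)) \<in> L i) F"
      by (rule eventually_subst[symmetric])
    then show ?thesis
      by (simp add: x(1) y(1) germ_map_germ germ_in_germ_rel)
  qed
  have "partial_order_on ?X ?L"
    unfolding partial_order_on_def preorder_on_def refl_on_def
    using antisymI[OF anti] refl tr order_trans[OF LE field] by blast
  moreover have "equiv ?X ?E"
    unfolding equiv_def refl_on_def using field trE symE LE refl by blast
  ultimately show ?thesis
    unfolding concrete_base_def using LE graph inj surj mono by (simp add: bij_betw_def)
qed

lemma up_sets_germ:
  assumes "eventually (\<lambda>i. R i \<in> up_sets (L i) (E i)) F"
  shows "germ_rel F R \<in> up_sets (germ_rel F L) (germ_rel F E)"
proof -
  have "germ_rel F R \<subseteq> germ_rel F E"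
    by (rule germ_rel_mono, use assms in eventually_elim) (simp add: up_sets_def)
  moreover have "(p', q') \<in> germ_rel F R"
    if "(p, q) \<in> germ_rel F R" "(p', q') \<in> germ_rel F E"
      "(p', p) \<in> germ_rel F L" "(q, q') \<in> germ_rel F L" for p q p' q'
  proof -
    obtain x y where x: "p = germ F x" "q = germ F y"
      using \<open>(p, q) \<in> germ_rel F R\<close> by (rule germ_relE)
    obtain x' y' where y: "p' = germ F x'" "q' = germ F y'"
      using \<open>(p', q') \<in> germ_rel F E\<close> by (rule germ_relE)
    note xy = x y
    have "eventually (\<lambda>i. (x i, y i) \<in> R i) F" "eventually (\<lambda>i. (x' i, y' i) \<in> E i) F"
      "eventually (\<lambda>i. (x' i, x i) \<in> L i) F" "eventually (\<lambda>i. (y i, y' i) \<in> L i) F"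
      using that by (simp_all add: xy germ_in_germ_rel)
    with assms have "eventually (\<lambda>i. (x' i, y' i) \<in> R i) F"
      by eventually_elim (auto simp: up_sets_def pair_le_def)
    then show ?thesis by (simp add: xy germ_in_germ_rel)
  qed
  ultimately show ?thesis by (auto simp: up_sets_def pair_le_def)
qed

end

section \<open>The ultraproduct of the algebras and its embedding\<close>

lemma UN_const:
  assumes "\<And>x. x \<in> S \<Longrightarrow> T x = C" "S \<noteq> {}" shows "(\<Union>x\<in>S. T x) = C"
  using assms by auto

locale ultraproduct_of = ultrafilter F for F :: "'i filter" +
  fixes I :: "'i set" and A :: "'i \<Rightarrow> 'a fl_algebra"
  assumes eventually_index: "eventually (\<lambda>i. i \<in> I) F"
    and closed: "i \<in> I \<Longrightarrow> fl_subuniverse (carrier (A i)) (A i)"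
begin

abbreviation "P \<equiv> \<Pi>\<^sub>E i\<in>I. carrier (A i)"
abbreviation "U \<equiv> ultraproduct I F A"

text \<open>Unlike germs of base points, these classes live inside the product of the carriers,
  which is inhabited because each carrier contains its unit.\<close>

definition cls :: "('i \<Rightarrow> 'a) \<Rightarrow> ('i \<Rightarrow> 'a) set" where
  "cls f = ultra_rel I F A `` {f}"

lemma in_cls: "f \<in> P \<Longrightarrow> g \<in> cls f \<longleftrightarrow> g \<in> P \<and> eventually (\<lambda>i. f i = g i) F"
  by (simp add: cls_def ultra_rel_def)

lemma cls_self: "f \<in> P \<Longrightarrow> f \<in> cls f"
  by (simp add: in_cls)

lemma cls_eq_iff:
  assumes f: "f \<in> P" and g: "g \<in> P"
  shows "cls f = cls g \<longleftrightarrow> eventually (\<lambda>i. f i = g i) F"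
proof
  assume "cls f = cls g"
  then have "g \<in> cls f" using cls_self[OF g] by simp
  then show "eventually (\<lambda>i. f i = g i) F" using f by (simp add: in_cls)
next
  assume *: "eventually (\<lambda>i. f i = g i) F"
  have "eventually (\<lambda>i. f i = k i) F \<longleftrightarrow> eventually (\<lambda>i. g i = k i) F" for k
    by (rule eventually_subst, use * in eventually_elim) simp
  then show "cls f = cls g" using f g in_cls by blast
qed

text \<open>Operations of \<open>ultraproduct\<close> are unions over all representatives; the union
  collapses because every representative yields the same class. Closure keeps the results in
  \<open>P\<close>, where \<open>cls_eq_iff\<close> applies.\<close>

lemma un_cls:
  assumes f: "f \<in> P" and op: "\<And>i a. i \<in> I \<Longrightarrow> a \<in> carrier (A i) \<Longrightarrow> opr (A i) a \<in> carrier (A i)"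
  shows "(\<Union>f\<in>cls f. cls (\<lambda>i\<in>I. opr (A i) (f i))) = cls (\<lambda>i\<in>I. opr (A i) (f i))"
proof (rule UN_const)
  fix f' assume "f' \<in> cls f"
  then have f': "f' \<in> P" "eventually (\<lambda>i. f i = f' i) F" using f by (auto simp: in_cls)
  have "eventually (\<lambda>i. (\<lambda>i\<in>I. opr (A i) (f' i)) i = (\<lambda>i\<in>I. opr (A i) (f i)) i) F"
    using f'(2) by eventually_elim simp
  moreover have "(\<lambda>i\<in>I. opr (A i) (f i)) \<in> P" if "f \<in> P" for f
    using that op by (simp add: PiE_iff)
  ultimately show "cls (\<lambda>i\<in>I. opr (A i) (f' i)) = cls (\<lambda>i\<in>I. opr (A i) (f i))"
    using f f'(1) by (subst cls_eq_iff)
qed (use cls_self[OF f] in auto)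

lemma bin_cls:
  assumes f: "f \<in> P" and g: "g \<in> P"
    and op: "\<And>i a b. i \<in> I \<Longrightarrow> a \<in> carrier (A i) \<Longrightarrow> b \<in> carrier (A i)
      \<Longrightarrow> opr (A i) a b \<in> carrier (A i)"
  shows "(\<Union>f\<in>cls f. \<Union>g\<in>cls g. cls (\<lambda>i\<in>I. opr (A i) (f i) (g i))) =
    cls (\<lambda>i\<in>I. opr (A i) (f i) (g i))"
proof (rule UN_const, rule UN_const)
  fix f' g' assume "f' \<in> cls f" "g' \<in> cls g"
  then have f': "f' \<in> P" "eventually (\<lambda>i. f i = f' i) F"
    and g': "g' \<in> P" "eventually (\<lambda>i. g i = g' i) F" using f g by (auto simp: in_cls)
  have "eventually (\<lambda>i. (\<lambda>i\<in>I. opr (A i) (f' i) (g' i)) i =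
      (\<lambda>i\<in>I. opr (A i) (f i) (g i)) i) F"
    using f'(2) g'(2) by eventually_elim simp
  moreover have "(\<lambda>i\<in>I. opr (A i) (f i) (g i)) \<in> P" if "f \<in> P" "g \<in> P" for f g
    using that op by (simp add: PiE_iff)
  ultimately show "cls (\<lambda>i\<in>I. opr (A i) (f' i) (g' i)) = cls (\<lambda>i\<in>I. opr (A i) (f i) (g i))"
    using f f'(1) g g'(1) by (subst cls_eq_iff)
qed (use cls_self[OF f] cls_self[OF g] in auto)

lemma carrier_ultraproduct: "carrier U = cls ` P"
  by (auto simp: ultraproduct_def Let_def quotient_def cls_def)

lemma one_ultraproduct: "\<one>\<^bsub>U\<^esub> = cls (\<lambda>i\<in>I. \<one>\<^bsub>A i\<^esub>)"
  by (simp add: ultraproduct_def Let_def cls_def)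

lemma ops_ultraproduct:
  assumes "f \<in> P" "g \<in> P"
  shows "cls f \<otimes>\<^bsub>U\<^esub> cls g = cls (\<lambda>i\<in>I. f i \<otimes>\<^bsub>A i\<^esub> g i)"
    and "wedge U (cls f) (cls g) = cls (\<lambda>i\<in>I. wedge (A i) (f i) (g i))"
    and "vee U (cls f) (cls g) = cls (\<lambda>i\<in>I. vee (A i) (f i) (g i))"
    and "rneg U (cls f) = cls (\<lambda>i\<in>I. rneg (A i) (f i))"
    and "lneg U (cls f) = cls (\<lambda>i\<in>I. lneg (A i) (f i))"
proof -
  have cl: "a \<otimes>\<^bsub>A i\<^esub> b \<in> carrier (A i)" "wedge (A i) a b \<in> carrier (A i)"
    "vee (A i) a b \<in> carrier (A i)"
    "rneg (A i) a \<in> carrier (A i)" "lneg (A i) a \<in> carrier (A i)"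
    if "i \<in> I" "a \<in> carrier (A i)" "b \<in> carrier (A i)" for i a b
    using closed[OF that(1)] that by (auto simp: fl_subuniverse_def)
  show "cls f \<otimes>\<^bsub>U\<^esub> cls g = cls (\<lambda>i\<in>I. f i \<otimes>\<^bsub>A i\<^esub> g i)"
    using bin_cls[of f g mult] assms cl(1)
    by (simp add: ultraproduct_def Let_def cls_def[symmetric])
  show "wedge U (cls f) (cls g) = cls (\<lambda>i\<in>I. wedge (A i) (f i) (g i))"
    using bin_cls[of f g wedge] assms cl(2)
    by (simp add: ultraproduct_def Let_def cls_def[symmetric])
  show "vee U (cls f) (cls g) = cls (\<lambda>i\<in>I. vee (A i) (f i) (g i))"
    using bin_cls[of f g vee] assms cl(3)
    by (simp add: ultraproduct_def Let_def cls_def[symmetric])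
  show "rneg U (cls f) = cls (\<lambda>i\<in>I. rneg (A i) (f i))"
    using un_cls[of f rneg] assms cl(4)
    by (simp add: ultraproduct_def Let_def cls_def[symmetric])
  show "lneg U (cls f) = cls (\<lambda>i\<in>I. lneg (A i) (f i))"
    using un_cls[of f lneg] assms cl(5)
    by (simp add: ultraproduct_def Let_def cls_def[symmetric])
qed

lemma restrict_in_P:
  assumes "f \<in> P" "g \<in> P"
  shows "(\<lambda>i\<in>I. f i \<otimes>\<^bsub>A i\<^esub> g i) \<in> P" "(\<lambda>i\<in>I. wedge (A i) (f i) (g i)) \<in> P"
    "(\<lambda>i\<in>I. vee (A i) (f i) (g i)) \<in> P" "(\<lambda>i\<in>I. rneg (A i) (f i)) \<in> P"
    "(\<lambda>i\<in>I. lneg (A i) (f i)) \<in> P"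
  using closed assms by (auto simp: fl_subuniverse_def PiE_iff)

lemma one_in_P: "(\<lambda>i\<in>I. \<one>\<^bsub>A i\<^esub>) \<in> P"
  using closed by (auto simp: fl_subuniverse_def)

lemma ultraproduct_closed: "fl_subuniverse (carrier U) U"
proof -
  have "wedge U C D \<in> carrier U \<and> vee U C D \<in> carrier U \<and> C \<otimes>\<^bsub>U\<^esub> D \<in> carrier U \<and>
      rneg U C \<in> carrier U \<and> lneg U C \<in> carrier U"
    if CD: "C \<in> carrier U" "D \<in> carrier U" for C D
  proof -
    obtain f g where "f \<in> P" "g \<in> P" "C = cls f" "D = cls g"
      using CD unfolding carrier_ultraproduct by blast
    then show ?thesis
      using restrict_in_P[of f g]
      by (simp only: ops_ultraproduct carrier_ultraproduct imageI simp_thms)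
  qed
  moreover have "\<one>\<^bsub>U\<^esub> \<in> carrier U"
    unfolding one_ultraproduct carrier_ultraproduct using one_in_P by (rule imageI)
  ultimately show ?thesis unfolding fl_subuniverse_def by blast
qed

text \<open>The class of \<open>f\<close> is represented by the lift of the relations
  \<open>h i (f i)\<close>. Each operation is then a lifting law followed by the homomorphism
  property of \<open>h i\<close> at the indices in \<open>I\<close>.\<close>

lemma ultraproduct_embedding:
  fixes X :: "'i \<Rightarrow> 'x set"
  assumes base: "\<And>i. i \<in> I \<Longrightarrow> concrete_base (X i) (L i) (E i) (\<alpha> i)"
    and emb: "\<And>i. i \<in> I \<Longrightarrow> fl_embedding (A i) (concrete_algebra (X i) (L i) (E i) (\<alpha> i)) (h i)"
  shows "concrete_base (germ_set F X) (germ_rel F L) (germ_rel F E) (germ_map F \<alpha>)"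
    and "\<exists>H. fl_embedding U
      (concrete_algebra (germ_set F X) (germ_rel F L) (germ_rel F E) (germ_map F \<alpha>)) H"
proof -
  show "concrete_base (germ_set F X) (germ_rel F L) (germ_rel F E) (germ_map F \<alpha>)"
    by (rule concrete_base_germ, use eventually_index in eventually_elim) (rule base)
  \<comment> \<open>Any representative would do: two of them agree almost everywhere, and so do the
    relations that they determine.\<close>
  define H where "H C = germ_rel F (\<lambda>i. h i ((SOME f. f \<in> C) i))" for C
  have H: "H (cls f) = germ_rel F (\<lambda>i. h i (f i))" if "f \<in> P" for f
  proof -
    have "(SOME g. g \<in> cls f) \<in> cls f" 
      using cls_self[OF that] by (rule someI[of "\<lambda>g. g \<in> cls f"])
    then have "eventually (\<lambda>i. f i = (SOME g. g \<in> cls f) i) F" using that by (simp add: in_cls)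
    then show ?thesis unfolding H_def germ_rel_eq_iff by eventually_elim simp
  qed
  \<comment> \<open>Nothing is known of the bases and embeddings outside \<open>I\<close>; since
    \<open>I\<close> is large, equations on \<open>I\<close> suffice.\<close>
  have ev: "germ_rel F R = germ_rel F S" if "\<And>i. i \<in> I \<Longrightarrow> R i = S i"
    for R S :: "'i \<Rightarrow> 'x rel"
    by (rule germ_rel_cong, use eventually_index in eventually_elim) (rule that)
  have mem: "f i \<in> carrier (A i)" if "f \<in> P" "i \<in> I" for f i
    using that by (auto simp: PiE_iff)
  have simps: "h i (wedge (A i) a b) = h i a \<inter> h i b" "h i (vee (A i) a b) = h i a \<union> h i b"
    "h i (a \<otimes>\<^bsub>A i\<^esub> b) = h i a O h i b"
    "h i (rneg (A i) a) = (E i - h i a)\<inverse> O aut_graph (X i) (\<alpha> i)"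
    "h i (lneg (A i) a) = aut_graph (X i) (\<alpha> i) O (E i - h i a)\<inverse>"
    "h i a \<in> up_sets (L i) (E i)" "inj_on (h i) (carrier (A i))"
    if "i \<in> I" "a \<in> carrier (A i)" "b \<in> carrier (A i)" for i a b
    using emb[OF that(1)] that(2,3)
    by (auto simp: fl_embedding_def concrete_algebra_def)
  let ?C = "concrete_algebra (germ_set F X) (germ_rel F L) (germ_rel F E) (germ_map F \<alpha>)"
  have "fl_embedding U ?C H"
    unfolding fl_embedding_def
  proof (intro conjI ballI)
    show "inj_on H (carrier U)"
      unfolding carrier_ultraproduct
    proof (rule inj_onI)
      fix C D assume "C \<in> cls ` P" "D \<in> cls ` P" and eq: "H C = H D"
      then obtain f g where fg: "f \<in> P" "g \<in> P" "C = cls f" "D = cls g" by blast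
      have "eventually (\<lambda>i. h i (f i) = h i (g i)) F"
        using eq fg by (simp add: H germ_rel_eq_iff)
      with eventually_index have "eventually (\<lambda>i. f i = g i) F"
        by eventually_elim (meson fg mem simps(7) inj_onD)
      then show "C = D" using fg by (simp add: cls_eq_iff)
    qed
    show "H ` carrier U \<subseteq> carrier ?C"
      unfolding carrier_ultraproduct
    proof clarify
      fix f assume f: "f \<in> P"
      have "eventually (\<lambda>i. h i (f i) \<in> up_sets (L i) (E i)) F"
        using eventually_index by eventually_elim (use simps(6) mem f in blast)
      then show "H (cls f) \<in> carrier ?C"
        using f by (simp add: H up_sets_germ concrete_algebra_def)
    qed
    show "H \<one>\<^bsub>U\<^esub> = \<one>\<^bsub>?C\<^esub>"
      unfolding one_ultraproduct H[OF one_in_P]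
      by (simp add: concrete_algebra_def)
        (rule ev, use emb in \<open>simp add: fl_embedding_def concrete_algebra_def\<close>)
  next
    fix C D assume "C \<in> carrier U" "D \<in> carrier U"
    then obtain f g where fg: "f \<in> P" "g \<in> P" and C: "C = cls f" and D: "D = cls g"
      unfolding carrier_ultraproduct by blast
    note unf = C D ops_ultraproduct[OF fg] H[OF fg(1)] H[OF fg(2)] restrict_in_P[OF fg, THEN H]
    show "H (wedge U C D) = wedge ?C (H C) (H D)"
      unfolding unf
      by (simp add: concrete_algebra_def germ_rel_Int[symmetric])
        (rule ev, simp add: simps mem fg)
    show "H (vee U C D) = vee ?C (H C) (H D)"
      unfolding unf
      by (simp add: concrete_algebra_def germ_rel_Un[symmetric])
        (rule ev, simp add: simps mem fg)
    show "H (C \<otimes>\<^bsub>U\<^esub> D) = H C \<otimes>\<^bsub>?C\<^esub> H D"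
      unfolding unf
      by (simp add: concrete_algebra_def germ_rel_relcomp[symmetric])
        (rule ev, simp add: simps mem fg)
  next
    fix C assume "C \<in> carrier U"
    then obtain f where f: "f \<in> P" and C: "C = cls f"
      unfolding carrier_ultraproduct by blast
    note unf = C ops_ultraproduct(4,5)[OF f f] H[OF f] restrict_in_P(4,5)[OF f f, THEN H]
    show "H (rneg U C) = rneg ?C (H C)"
      unfolding unf
      by (simp add: concrete_algebra_def germ_rel_aut_graph[symmetric] germ_rel_Diff[symmetric]
          germ_rel_converse[symmetric] germ_rel_relcomp[symmetric])
        (rule ev, simp add: simps(4)[OF _ mem[OF f] mem[OF f]])
    show "H (lneg U C) = lneg ?C (H C)"
      unfolding unf
      by (simp add: concrete_algebra_def germ_rel_aut_graph[symmetric] germ_rel_Diff[symmetric]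
          germ_rel_converse[symmetric] germ_rel_relcomp[symmetric])
        (rule ev, simp add: simps(5)[OF _ mem[OF f] mem[OF f]])
  qed
  then show "\<exists>H. fl_embedding U ?C H" by blast
qed

end

text \<open>The base is kept in the form \<open>germ_set F X\<close>, so that its size can be
  bounded when the type of points is finite.\<close>

lemma ultraproduct_of_RDInFL:
  assumes "ultrafilter_on I F" and A: "\<forall>i\<in>I. A i \<in> RDInFL TYPE('x)"
  shows "ultraproduct_of F I A"
    and "\<exists>X L E \<alpha> (H :: _ \<Rightarrow> ('i \<Rightarrow> 'x) set rel).
      concrete_base (germ_set F X) L E \<alpha> \<and>
      fl_embedding (ultraproduct I F A) (concrete_algebra (germ_set F X) L E \<alpha>) H"
proof -
  show "ultraproduct_of F I A"
    using assms
    by unfold_locales (auto simp: ultrafilter_on_def le_principal RDInFL_iff)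
  then interpret ultraproduct_of F I A .
  have "\<forall>i\<in>I. \<exists>(X :: 'x set) L E \<alpha> h. concrete_base X L E \<alpha> \<and>
      fl_embedding (A i) (concrete_algebra X L E \<alpha>) h"
    using A by (simp add: RDInFL_iff)
  then obtain X :: "'i \<Rightarrow> 'x set" and L E \<alpha> h where
    *: "\<forall>i\<in>I. concrete_base (X i) (L i) (E i) (\<alpha> i) \<and>
      fl_embedding (A i) (concrete_algebra (X i) (L i) (E i) (\<alpha> i)) (h i)"
    by metis
  show "\<exists>X L E \<alpha> (H :: _ \<Rightarrow> ('i \<Rightarrow> 'x) set rel).
      concrete_base (germ_set F X) L E \<alpha> \<and>
      fl_embedding (ultraproduct I F A) (concrete_algebra (germ_set F X) L E \<alpha>) H"
    using ultraproduct_embedding[of X L E \<alpha> h] * by blast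
qed

unbundle cardinal_syntax

section \<open>Shrinking the base poset\<close>

definition pullback_rel :: "'z set \<Rightarrow> ('z \<Rightarrow> 'x) \<Rightarrow> 'x rel \<Rightarrow> 'z rel" where
  "pullback_rel Z k R = {(u, v). u \<in> Z \<and> v \<in> Z \<and> (k u, k v) \<in> R}"

lemma pullback_rel_iff: "(u, v) \<in> pullback_rel Z k R \<longleftrightarrow> u \<in> Z \<and> v \<in> Z \<and> (k u, k v) \<in> R"
  by (simp add: pullback_rel_def)

lemma (in concrete) pullback_embedding:
  fixes k :: "'z \<Rightarrow> 'x" and A :: "'a fl_algebra"
  assumes emb: "fl_embedding A (concrete_algebra X L E \<alpha>) h"
    and inj: "inj_on k Z" and kX: "k ` Z \<subseteq> X" and aut: "\<alpha> ` k ` Z = k ` Z"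
    and witness: "\<And>a b x y. \<lbrakk>a \<in> carrier A; b \<in> carrier A; x \<in> k ` Z; y \<in> k ` Z;
      (x, y) \<in> h a O h b\<rbrakk> \<Longrightarrow> \<exists>z\<in>k ` Z. (x, z) \<in> h a \<and> (z, y) \<in> h b"
    and separate: "\<And>a b. \<lbrakk>a \<in> carrier A; b \<in> carrier A; a \<noteq> b\<rbrakk>
      \<Longrightarrow> \<exists>x\<in>k ` Z. \<exists>y\<in>k ` Z. (x, y) \<in> h a \<longleftrightarrow> (x, y) \<notin> h b"
  defines "\<beta> \<equiv> \<lambda>u. inv_into Z k (\<alpha> (k u))" and "p \<equiv> pullback_rel Z k"
  shows "concrete_base Z (p L) (p E) \<beta>"
    and "fl_embedding A (concrete_algebra Z (p L) (p E) \<beta>) (\<lambda>a. p (h a))"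
proof -
  have p_iff: "(u, v) \<in> p R \<longleftrightarrow> u \<in> Z \<and> v \<in> Z \<and> (k u, k v) \<in> R" for u v R
    by (simp add: p_def pullback_rel_iff)
  have k_beta: "k (\<beta> u) = \<alpha> (k u)" and beta_in: "\<beta> u \<in> Z" if "u \<in> Z" for u
  proof -
    have "\<alpha> (k u) \<in> k ` Z" using that aut by blast
    then show "k (\<beta> u) = \<alpha> (k u)" "\<beta> u \<in> Z"
      unfolding \<beta>_def by (simp_all add: f_inv_into_f inv_into_into)
  qed
  have k_in: "k u \<in> X" if "u \<in> Z" for u using that kX by blast
  have k_eq: "k u = k v \<longleftrightarrow> u = v" if "u \<in> Z" "v \<in> Z" for u v
    using inj that by (auto dest: inj_onD)
  have beta_eqI: "\<beta> u = v \<longleftrightarrow> \<alpha> (k u) = k v" if "u \<in> Z" "v \<in> Z" for u v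
    using k_eq[OF beta_in[OF that(1)] that(2)] k_beta[OF that(1)] by simp
  have graph: "aut_graph Z \<beta> = p (aut_graph X \<alpha>)"
  proof (intro equalityI subrelI)
    fix u v assume "(u, v) \<in> aut_graph Z \<beta>"
    then have "u \<in> Z" "v = \<beta> u" by (auto simp: aut_graph_def)
    then show "(u, v) \<in> p (aut_graph X \<alpha>)"
      by (simp add: p_iff beta_in k_beta aut_graph_def k_in)
  next
    fix u v assume "(u, v) \<in> p (aut_graph X \<alpha>)"
    then have "u \<in> Z" "v \<in> Z" "\<alpha> (k u) = k v" by (auto simp: p_iff aut_graph_def)
    then have "u \<in> Z" "v = \<beta> u" using beta_eqI by auto
    then show "(u, v) \<in> aut_graph Z \<beta>" by (simp add: aut_graph_def)
  qed
  have surj: "\<exists>w\<in>Z. \<beta> w = v" if v: "v \<in> Z" for v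
  proof -
    have "k v \<in> \<alpha> ` k ` Z" using v aut by simp
    then obtain w where "w \<in> Z" "\<alpha> (k w) = k v" by auto
    then show ?thesis using v beta_eqI by blast
  qed
  have inj_b: "inj_on \<beta> Z"
  proof (rule inj_onI)
    fix u v assume *: "u \<in> Z" "v \<in> Z" "\<beta> u = \<beta> v"
    then have "\<alpha> (k u) = \<alpha> (k v)" using k_beta by metis
    then have "k u = k v" using aut_inj k_in * by (simp add: inj_on_def)
    then show "u = v" using k_eq * by simp
  qed
  have bij: "bij_betw \<beta> Z Z"
    unfolding bij_betw_def using inj_b beta_in surj by blast
  show "concrete_base Z (p L) (p E) \<beta>"
    unfolding concrete_base_def partial_order_on_def preorder_on_def equiv_def refl_on_def
  proof (intro conjI bij ballI)
    show "p L \<subseteq> Z \<times> Z" "p E \<subseteq> Z \<times> Z" "p L \<subseteq> p E"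
      using L_E by (auto simp: p_iff)
    show "trans (p L)" by (rule transI) (auto simp: p_iff intro: L_trans)
    show "trans (p E)" by (rule transI) (auto simp: p_iff intro: E_trans)
    show "sym (p E)" by (rule symI) (auto simp: p_iff intro: E_sym)
    show "antisym (p L)" by (rule antisymI) (metis p_iff L_antisym k_eq)
    show "aut_graph Z \<beta> \<subseteq> p E"
      unfolding graph using aut_E by (auto simp: p_iff aut_graph_def)
  qed (simp_all add: p_iff L_refl E_refl k_in beta_in k_beta aut_L)
  have cl: "h a \<in> up_sets L E" if "a \<in> carrier A" for a
    using emb that by (auto simp: fl_embedding_def concrete_simps)
  have hom: "h (wedge A a b) = h a \<inter> h b" "h (vee A a b) = h a \<union> h b"
    "h (a \<otimes>\<^bsub>A\<^esub> b) = h a O h b"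
    "h (rneg A a) = (E - h a)\<inverse> O aut_graph X \<alpha>" "h (lneg A a) = aut_graph X \<alpha> O (E - h a)\<inverse>"
    if "a \<in> carrier A" "b \<in> carrier A" for a b
    using emb that by (simp_all add: fl_embedding_def concrete_algebra_def)
  have one: "h \<one>\<^bsub>A\<^esub> = L" using emb by (simp add: fl_embedding_def concrete_algebra_def)
  let ?C = "concrete_algebra Z (p L) (p E) \<beta>"
  show "fl_embedding A ?C (\<lambda>a. p (h a))"
    unfolding fl_embedding_def
  proof (intro conjI ballI)
    show "inj_on (\<lambda>a. p (h a)) (carrier A)"
    proof (rule inj_onI, rule ccontr)
      fix a b assume *: "a \<in> carrier A" "b \<in> carrier A" "p (h a) = p (h b)" "a \<noteq> b"
      from separate[OF *(1,2,4)] obtain u v where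
        "u \<in> Z" "v \<in> Z" "(k u, k v) \<in> h a \<longleftrightarrow> (k u, k v) \<notin> h b" by blast
      then have "(u, v) \<in> p (h a) \<longleftrightarrow> (u, v) \<notin> p (h b)" by (simp add: p_iff)
      then show False using *(3) by simp
    qed
    show "(\<lambda>a. p (h a)) ` carrier A \<subseteq> carrier ?C"
    proof (rule image_subsetI)
      fix a assume "a \<in> carrier A"
      note up_set = cl[OF this]
      then have up: "(x', y') \<in> h a" if "(x, y) \<in> h a" "(x', y') \<in> E" "(x', x) \<in> L" "(y, y') \<in> L"
        for x y x' y'
        using that by (auto simp: up_sets_def pair_le_def)
      have "h a \<subseteq> E" using up_set by (rule up_sets_sub)
      then show "p (h a) \<in> carrier ?C"
        by (auto simp: concrete_algebra_def up_sets_def pair_le_def p_iff intro: up)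
    qed
    show "p (h \<one>\<^bsub>A\<^esub>) = \<one>\<^bsub>?C\<^esub>" by (simp add: one concrete_algebra_def)
  next
    fix a b assume ab: "a \<in> carrier A" "b \<in> carrier A"
    show "p (h (wedge A a b)) = wedge ?C (p (h a)) (p (h b))"
      using ab by (auto simp: hom concrete_algebra_def p_iff)
    show "p (h (vee A a b)) = vee ?C (p (h a)) (p (h b))"
      using ab by (auto simp: hom concrete_algebra_def p_iff)
    have "p (h a O h b) = p (h a) O p (h b)"
    proof (intro equalityI subrelI)
      fix u v assume "(u, v) \<in> p (h a O h b)"
      then have uv: "u \<in> Z" "v \<in> Z" "(k u, k v) \<in> h a O h b" by (simp_all add: p_iff)
      then obtain w where "w \<in> Z" "(k u, k w) \<in> h a" "(k w, k v) \<in> h b"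
        using witness[OF ab] by blast
      then have "(u, w) \<in> p (h a)" "(w, v) \<in> p (h b)" using uv by (simp_all add: p_iff)
      then show "(u, v) \<in> p (h a) O p (h b)" by blast
    qed (auto simp: p_iff)
    then show "p (h (a \<otimes>\<^bsub>A\<^esub> b)) = p (h a) \<otimes>\<^bsub>?C\<^esub> p (h b)"
      using ab by (simp add: hom concrete_algebra_def)
  next
    fix a assume a: "a \<in> carrier A"
    have diff: "p E - p (h a) = p (E - h a)" by (auto simp: p_iff)
    have "p ((E - h a)\<inverse> O aut_graph X \<alpha>) = (p (E - h a))\<inverse> O aut_graph Z \<beta>"
    proof (intro equalityI subrelI)
      fix u v assume "(u, v) \<in> p ((E - h a)\<inverse> O aut_graph X \<alpha>)"
      then obtain x where uv: "u \<in> Z" "v \<in> Z" and x: "(x, k u) \<in> E - h a" "x \<in> X" "k v = \<alpha> x"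
        by (auto simp: p_iff aut_graph_def)
      \<comment> \<open>The middle point is forced: it is the \<alpha>-preimage of
        \<open>k v\<close>, hence named by the \<beta>-preimage of \<open>v\<close>.\<close>
      from surj[OF uv(2)] obtain w where w: "w \<in> Z" "v = \<beta> w" by blast
      then have "x = k w"
        using x k_beta k_in aut_inj by (simp add: inj_on_def)
      then have "(w, u) \<in> p (E - h a)" "(w, v) \<in> aut_graph Z \<beta>"
        using x w uv by (auto simp: p_iff aut_graph_def)
      then show "(u, v) \<in> (p (E - h a))\<inverse> O aut_graph Z \<beta>" by blast
    qed (auto simp: graph p_iff)
    then show "p (h (rneg A a)) = rneg ?C (p (h a))"
      using a by (simp add: hom concrete_algebra_def diff)
    have "p (aut_graph X \<alpha> O (E - h a)\<inverse>) = aut_graph Z \<beta> O (p (E - h a))\<inverse>"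
    proof (intro equalityI subrelI)
      fix u v assume "(u, v) \<in> p (aut_graph X \<alpha> O (E - h a)\<inverse>)"
      then have uv: "u \<in> Z" "v \<in> Z" "(k v, \<alpha> (k u)) \<in> E - h a"
        by (auto simp: p_iff aut_graph_def)
      then have "(v, \<beta> u) \<in> p (E - h a)" "(u, \<beta> u) \<in> aut_graph Z \<beta>"
        by (simp_all add: p_iff aut_graph_def beta_in k_beta)
      then show "(u, v) \<in> aut_graph Z \<beta> O (p (E - h a))\<inverse>" by blast
    qed (auto simp: graph p_iff)
    then show "p (h (lneg A a)) = lneg ?C (p (h a))"
      using a by (simp add: hom concrete_algebra_def diff)
  qed
qed

lemma (in concrete) RDInFL_subbase:
  fixes A :: "'a fl_algebra"
  assumes closed: "fl_subuniverse (carrier A) A"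
    and emb: "fl_embedding A (concrete_algebra X L E \<alpha>) h"
    and Y: "Y \<subseteq> X" "\<alpha> ` Y = Y" "|Y| \<le>o |UNIV :: 'u set|"
    and witness: "\<And>a b x y. \<lbrakk>a \<in> carrier A; b \<in> carrier A; x \<in> Y; y \<in> Y;
      (x, y) \<in> h a O h b\<rbrakk> \<Longrightarrow> \<exists>z\<in>Y. (x, z) \<in> h a \<and> (z, y) \<in> h b"
    and separate: "\<And>a b. \<lbrakk>a \<in> carrier A; b \<in> carrier A; a \<noteq> b\<rbrakk>
      \<Longrightarrow> \<exists>x\<in>Y. \<exists>y\<in>Y. (x, y) \<in> h a \<longleftrightarrow> (x, y) \<notin> h b"
  shows "A \<in> RDInFL TYPE('u)"
proof -
  obtain g :: "'x \<Rightarrow> 'u" where g: "inj_on g Y"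
    using Y(3) unfolding card_of_ordLeq[symmetric] by blast
  \<comment> \<open>\<open>g\<close> gives the points of \<open>Y\<close> names in
    \<open>'u\<close>; the names form the new base, and \<open>k\<close> reads them back.\<close>
  define k where "k = inv_into Y g"
  have inj: "inj_on k (g ` Y)" unfolding k_def by (rule inj_on_inv_into) simp
  have im: "k ` g ` Y = Y" unfolding k_def using g by (force simp: image_image)
  note pb = pullback_embedding[OF emb inj, unfolded im, OF Y(1,2) witness separate]
  show ?thesis
    unfolding RDInFL_iff
    by (intro conjI closed exI) (rule pb; assumption)+
qed

lemma (in concrete) RDInFL_whole_base:
  fixes A :: "'a fl_algebra"
  assumes closed: "fl_subuniverse (carrier A) A"
    and emb: "fl_embedding A (concrete_algebra X L E \<alpha>) h"
    and small: "|X| \<le>o |UNIV :: 'u set|"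
  shows "A \<in> RDInFL TYPE('u)"
proof -
  have sub: "h a \<subseteq> E" if "a \<in> carrier A" for a
    using emb that by (auto simp: fl_embedding_def concrete_simps up_sets_def)
  show ?thesis
  proof (rule RDInFL_subbase[OF closed emb order_refl _ small])
    show "\<alpha> ` X = X"
      using base by (simp add: concrete_base_def bij_betw_def)
  next
    fix a b x y assume "a \<in> carrier A" "(x, y) \<in> h a O h b"
    then show "\<exists>z\<in>X. (x, z) \<in> h a \<and> (z, y) \<in> h b"
      using sub E_field by blast
  next
    fix a b assume *: "a \<in> carrier A" "b \<in> carrier A" "a \<noteq> b"
    then have "h a \<noteq> h b"
      using emb unfolding fl_embedding_def inj_on_def by blast
    then obtain x y where xy: "(x, y) \<in> h a \<longleftrightarrow> (x, y) \<notin> h b" by auto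
    then have "(x, y) \<in> E" using sub[OF *(1)] sub[OF *(2)] by blast
    then show "\<exists>x\<in>X. \<exists>y\<in>X. (x, y) \<in> h a \<longleftrightarrow> (x, y) \<notin> h b"
      using E_field xy by blast
  qed
qed

section \<open>Skolem hulls of bounded cardinality\<close>

lemma card_of_Un_ordLeq_infinite:
  assumes "infinite B" "|A1| \<le>o |B|" "|A2| \<le>o |B|"
  shows "|A1 \<union> A2| \<le>o |B|"
  using assms by (intro card_of_Un_ordLeq_infinite_Field) (simp_all add: Field_card_of card_of_card_order_on)

text \<open>A union of countably many one-step extensions; an infinite bound absorbs the products in
  each step and the union. Binary functions suffice: a middle point depends on two endpoints, and a
  unary map can ignore one argument.\<close>

lemma card_of_closure:
  fixes Y\<^sub>0 :: "'y set" and G :: "('y \<Rightarrow> 'y \<Rightarrow> 'y) set"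
  assumes inf: "infinite B" and Y0: "|Y\<^sub>0| \<le>o |B|" and G: "|G| \<le>o |B|"
  obtains Y where "Y\<^sub>0 \<subseteq> Y" "\<And>g x y. g \<in> G \<Longrightarrow> x \<in> Y \<Longrightarrow> y \<in> Y \<Longrightarrow> g x y \<in> Y" "|Y| \<le>o |B|"
proof -
  define step where "step Y = Y \<union> (\<lambda>(g, x, y). g x y) ` (G \<times> Y \<times> Y)" for Y
  define S where "S n = (step ^^ n) Y\<^sub>0" for n
  have S_Suc: "S (Suc n) = step (S n)" for n by (simp add: S_def)
  have card_S: "|S n| \<le>o |B|" for n
  proof (induction n)
    case 0
    then show ?case using Y0 by (simp add: S_def)
  next
    case (Suc n)
    have "|S n \<times> S n| \<le>o |B|"
      using Suc by (intro card_of_Sigma_ordLeq_infinite[OF inf] ballI)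
    then have "|G \<times> S n \<times> S n| \<le>o |B|"
      by (intro card_of_Sigma_ordLeq_infinite[OF inf G] ballI)
    then have "|(\<lambda>(g, x, y). g x y) ` (G \<times> S n \<times> S n)| \<le>o |B|"
      using card_of_image ordLeq_transitive by blast
    then show ?case
      unfolding S_Suc step_def by (rule card_of_Un_ordLeq_infinite[OF inf Suc])
  qed
  have mono: "S m \<subseteq> S n" if "m \<le> n" for m n
    using that by (rule lift_Suc_mono_le[rotated]) (auto simp: S_Suc step_def)
  show thesis
  proof (rule that[of "\<Union>n. S n"])
    show "Y\<^sub>0 \<subseteq> (\<Union>n. S n)" using UN_upper[of 0 UNIV S] by (simp add: S_def)
    show "|\<Union>n. S n| \<le>o |B|"
      using card_of_UNION_ordLeq_infinite[OF inf, of "UNIV :: nat set" S]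
        inf infinite_iff_card_of_nat card_S by blast
  next
    fix g x y assume *: "g \<in> G" "x \<in> (\<Union>n. S n)" "y \<in> (\<Union>n. S n)"
    then obtain m n where "x \<in> S m" "y \<in> S n" by blast
    \<comment> \<open>The two arguments may appear at different stages; both are present at the
      later one.\<close>
    then have "x \<in> S (max m n)" "y \<in> S (max m n)"
      using mono[of m "max m n"] mono[of n "max m n"] by auto
    then have "g x y \<in> S (Suc (max m n))"
      unfolding S_Suc step_def using *(1) by force
    then show "g x y \<in> (\<Union>n. S n)" by blast
  qed
qed

text \<open>The downward Loewenheim-Skolem step: the witnesses for compositions and for the
  distinctness of elements are Skolem functions, and the new base is their hull.\<close>

lemma RDInFL_infinite:
  fixes A :: "'u fl_algebra"
  assumes inf: "infinite (UNIV :: 'u set)" and A: "A \<in> RDInFL TYPE('y)"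
  shows "A \<in> RDInFL TYPE('u)"
proof -
  obtain X :: "'y set" and L E \<alpha> h where closed: "fl_subuniverse (carrier A) A"
    and base: "concrete_base X L E \<alpha>" and emb: "fl_embedding A (concrete_algebra X L E \<alpha>) h"
    using A unfolding RDInFL_iff by blast
  interpret concrete X L E \<alpha> by unfold_locales fact
  have sub: "h a \<subseteq> E" if "a \<in> carrier A" for a
    using emb that by (auto simp: fl_embedding_def concrete_simps up_sets_def)
  \<comment> \<open>One Skolem function for each pair of elements, so their number is bounded by the
    size of \<open>'u \<times> 'u\<close>.\<close>
  define w where "w = (\<lambda>(a, b) x y. SOME z. (x, z) \<in> h a \<and> (z, y) \<in> h b)"
  define d where "d = (\<lambda>(a, b). SOME p. p \<in> h a \<longleftrightarrow> p \<notin> h b)"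
  let ?CC = "UNIV :: ('u \<times> 'u) set"
  \<comment> \<open>The inverse of \<alpha> is included so that \<alpha> maps the new base onto
    itself, not merely into itself.\<close>
  define G where "G = {\<lambda>x y. \<alpha> x} \<union> ({\<lambda>x y. inv_into X \<alpha> x} \<union> w ` ?CC)"
  define Y0 where "Y0 = fst ` d ` ?CC \<union> snd ` d ` ?CC"
  have CC: "|?CC| \<le>o |UNIV :: 'u set|"
    using card_of_Sigma_ordLeq_infinite[OF inf, of UNIV "\<lambda>_. UNIV"]
      card_of_mono1[OF subset_refl, of "UNIV :: 'u set"] by simp
  then have im: "|f ` ?CC| \<le>o |UNIV :: 'u set|" for f :: "'u \<times> 'u \<Rightarrow> 'b"
    using card_of_image ordLeq_transitive by blast
  have "|G| \<le>o |UNIV :: 'u set|"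
    unfolding G_def
    by (intro card_of_Un_ordLeq_infinite[OF inf] card_of_singl_ordLeq im) simp_all
  moreover have "|Y0| \<le>o |UNIV :: 'u set|"
    unfolding Y0_def image_image
    by (rule card_of_Un_ordLeq_infinite[OF inf im im])
  ultimately obtain Y where Y: "Y0 \<subseteq> Y"
    "\<And>g x y. g \<in> G \<Longrightarrow> x \<in> Y \<Longrightarrow> y \<in> Y \<Longrightarrow> g x y \<in> Y"
    "|Y| \<le>o |UNIV :: 'u set|"
    using card_of_closure[OF inf] by blast
  have G_in: "\<alpha> x \<in> Y" "inv_into X \<alpha> x \<in> Y" "w ab x y \<in> Y" if "x \<in> Y" "y \<in> Y" for x y ab
    using Y(2)[OF _ that, of "\<lambda>x y. \<alpha> x"] Y(2)[OF _ that, of "\<lambda>x y. inv_into X \<alpha> x"]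
      Y(2)[OF _ that, of "w ab"] by (auto simp: G_def)
  \<comment> \<open>The hull may leave \<open>X\<close>, because the choices in \<open>w\<close>,
    \<open>d\<close> and \<open>inv_into\<close> are arbitrary where no suitable point exists;
    genuine witnesses lie in \<open>X\<close>, so cutting back to \<open>X\<close> loses
    none.\<close>
  show ?thesis
  proof (rule RDInFL_subbase[OF closed emb, of "X \<inter> Y"])
    show "X \<inter> Y \<subseteq> X" by simp
    show "|X \<inter> Y| \<le>o |UNIV :: 'u set|"
      using card_of_mono1[of "X \<inter> Y" Y] Y(3) ordLeq_transitive by blast
    show "\<alpha> ` (X \<inter> Y) = X \<inter> Y"
    proof (rule equalityI; rule subsetI)
      fix x assume "x \<in> \<alpha> ` (X \<inter> Y)"
      then show "x \<in> X \<inter> Y" using aut_in G_in(1) by blast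
    next
      fix y assume y: "y \<in> X \<inter> Y"
      then obtain x where x: "x \<in> X" "y = \<alpha> x" using aut_surj by blast
      then have "inv_into X \<alpha> y = x" using aut_inj by simp
      then show "y \<in> \<alpha> ` (X \<inter> Y)" using G_in(2)[of y y] x y by blast
    qed
  next
    fix a b x y assume *: "a \<in> carrier A" "b \<in> carrier A" "x \<in> X \<inter> Y" "y \<in> X \<inter> Y"
      "(x, y) \<in> h a O h b"
    then have "\<exists>z. (x, z) \<in> h a \<and> (z, y) \<in> h b" by blast
    then have z: "(x, w (a, b) x y) \<in> h a \<and> (w (a, b) x y, y) \<in> h b"
      unfolding w_def prod.case by (rule someI_ex)
    moreover have "w (a, b) x y \<in> X" using z sub[OF *(1)] E_field by blast
    ultimately show "\<exists>z\<in>X \<inter> Y. (x, z) \<in> h a \<and> (z, y) \<in> h b"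
      using G_in(3)[of x y "(a, b)"] * by blast
  next
    fix a b assume *: "a \<in> carrier A" "b \<in> carrier A" "a \<noteq> b"
    then have "h a \<noteq> h b" using emb by (auto simp: fl_embedding_def dest: inj_onD)
    then have "\<exists>p. p \<in> h a \<longleftrightarrow> p \<notin> h b" by blast
    then have d: "d (a, b) \<in> h a \<longleftrightarrow> d (a, b) \<notin> h b"
      unfolding d_def prod.case by (rule someI_ex)
    obtain x y where xy: "d (a, b) = (x, y)" by (rule prod.exhaust)
    have "(x, y) \<in> E" using d xy sub *(1,2) by auto
    moreover have "x \<in> Y0" "y \<in> Y0"
      unfolding Y0_def using xy by (metis UnI1 UnI2 UNIV_I fst_conv snd_conv image_eqI)+
    ultimately show "\<exists>x\<in>X \<inter> Y. \<exists>y\<in>X \<inter> Y. (x, y) \<in> h a \<longleftrightarrow> (x, y) \<notin> h b"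
      using d Y(1) E_field unfolding xy by blast
  qed
qed

section \<open>Finite point types, one-point index sets and the equality of classes\<close>

lemma (in ultrafilter) germ_constant:
  fixes x :: "'i \<Rightarrow> 'u"
  assumes "finite (UNIV :: 'u set)"
  obtains u where "germ F x = germ F (\<lambda>_. u)"
proof -
  \<comment> \<open>The fibres of \<open>x\<close> form a finite partition; if none were large,
    their complements would have a large but empty intersection.\<close>
  have "\<exists>u. eventually (\<lambda>i. x i = u) F"
  proof (rule ccontr)
    assume "\<nexists>u. eventually (\<lambda>i. x i = u) F"
    then have "\<forall>u. eventually (\<lambda>i. x i \<noteq> u) F" by (simp add: not_eventually_iff)
    then have "eventually (\<lambda>i. \<forall>u\<in>UNIV. x i \<noteq> u) F"
      using assms by (intro eventually_ball_finite) simp_all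
    then show False using proper by simp
  qed
  then show thesis using that by (auto simp: germ_eq_iff)
qed

text \<open>A representation is found over germs and then brought back to \<open>'u\<close>. In the
  infinite case the size of the germ base is irrelevant, since the hull depends only on the size of
  \<open>'u\<close>.\<close>

lemma ultraproducts_RDInFL_subset:
  "ultraproducts TYPE('j) (RDInFL TYPE('u) :: 'u fl_algebra set)
    \<subseteq> (RDInFL TYPE('u) :: 'u fl_algebra set)"
proof
  fix B :: "'u fl_algebra"
  assume "B \<in> ultraproducts TYPE('j) (RDInFL TYPE('u) :: 'u fl_algebra set)"
  then obtain I :: "'j set" and F and A :: "'j \<Rightarrow> 'u fl_algebra" and g where
    B: "dinfl B" and uf: "ultrafilter_on I F" and A: "\<forall>i\<in>I. A i \<in> RDInFL TYPE('u)"
    and g: "fl_iso B (ultraproduct I F A) g"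
    unfolding ultraproducts_def fl_isomorphic_def by blast
  have ultra: "ultrafilter F"
    using ultraproduct_of_RDInFL(1)[OF uf A] by (rule ultraproduct_of.axioms)
  obtain X L E \<alpha> and H :: "_ \<Rightarrow> ('j \<Rightarrow> 'u) set rel" where
    base: "concrete_base (germ_set F X) L E \<alpha>" and
    H: "fl_embedding (ultraproduct I F A) (concrete_algebra (germ_set F X) L E \<alpha>) H"
    using ultraproduct_of_RDInFL(2)[OF uf A] by blast
  have closed: "fl_subuniverse (carrier B) B" using B by (rule dinfl_closed)
  have emb: "fl_embedding B (concrete_algebra (germ_set F X) L E \<alpha>) (H \<circ> g)"
    using fl_embedding_comp[OF fl_iso_imp_embedding[OF g] H] .
  show "B \<in> RDInFL TYPE('u)"
  proof (cases "finite (UNIV :: 'u set)")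
    case False
    have "B \<in> RDInFL TYPE(('j \<Rightarrow> 'u) set)"
      unfolding RDInFL_iff using closed base emb by blast
    with False show ?thesis by (rule RDInFL_infinite)
  next
    case True
    have "germ_set F X \<subseteq> range (\<lambda>u. germ F (\<lambda>_. u))"
    proof
      fix p assume "p \<in> germ_set F X"
      then obtain x where "p = germ F x" by (rule germ_setE)
      moreover obtain u where "germ F x = germ F (\<lambda>_. u)" 
        using ultrafilter.germ_constant[OF ultra True] by blast
      ultimately show "p \<in> range (\<lambda>u. germ F (\<lambda>_. u))" by blast
    qed
    then have small: "|germ_set F X| \<le>o |UNIV :: 'u set|"
      by (rule surj_imp_ordLeq)
    show ?thesis
      using concrete.intro[OF base] closed emb small by (rule concrete.RDInFL_whole_base)
  qed
qed

lemma ultrafilter_on_principal: "ultrafilter_on {i} (principal {i})"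
  by (auto simp: ultrafilter_on_def principal_eq_bot_iff eventually_principal)

text \<open>Over a single index, equality almost everywhere is equality at that index, so each class
  corresponds to one element. Thus every member of the class is an ultraproduct of members.\<close>

lemma ultraproduct_principal:
  fixes A :: "'a fl_algebra" and i :: 'i
  assumes closed: "fl_subuniverse (carrier A) A"
  shows "fl_isomorphic A (ultraproduct {i} (principal {i}) (\<lambda>_. A))"
proof -
  interpret ultraproduct_of "principal {i}" "{i}" "\<lambda>_. A"
    using closed by unfold_locales (auto simp: eventually_principal principal_eq_bot_iff)
  define h where "h a = cls (\<lambda>_\<in>{i}. a)" for a
  have in_P: "(\<lambda>_\<in>{i}. a) \<in> P" if "a \<in> carrier A" for a
    using that by simp
  have ops: "h (wedge A a b) = wedge U (h a) (h b)" "h (vee A a b) = vee U (h a) (h b)"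
    "h (a \<otimes>\<^bsub>A\<^esub> b) = h a \<otimes>\<^bsub>U\<^esub> h b" "h (rneg A a) = rneg U (h a)" "h (lneg A a) = lneg U (h a)"
    if "a \<in> carrier A" "b \<in> carrier A" for a b
    unfolding h_def ops_ultraproduct[OF in_P[OF that(1)] in_P[OF that(2)]]
    by (auto intro!: arg_cong[of _ _ cls] restrict_ext)
  have bij: "bij_betw h (carrier A) (carrier U)"
    unfolding bij_betw_def
  proof
    show "inj_on h (carrier A)"
    proof (rule inj_onI)
      fix a b assume ab: "a \<in> carrier A" "b \<in> carrier A" "h a = h b"
      show "a = b"
        using ab(3) unfolding h_def cls_eq_iff[OF in_P[OF ab(1)] in_P[OF ab(2)]]
        by (simp add: eventually_principal)
    qed
    show "h ` carrier A = carrier U"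
    proof (rule equalityI; rule subsetI)
      fix C assume "C \<in> h ` carrier A"
      then show "C \<in> carrier U"
        unfolding h_def carrier_ultraproduct using in_P by blast
    next
      fix C assume "C \<in> carrier U"
      then obtain f where f: "f \<in> P" "C = cls f" unfolding carrier_ultraproduct by blast
      have "f = (\<lambda>_\<in>{i}. f i)" using f(1) by (auto simp: PiE_iff extensional_def)
      moreover have "f i \<in> carrier A" using f(1) by (auto simp: PiE_iff)
      ultimately show "C \<in> h ` carrier A" unfolding h_def f(2) by (metis imageI)
    qed
  qed
  have "fl_iso A U h"
    unfolding fl_iso_def using bij ops one_ultraproduct by (auto simp: h_def)
  then show ?thesis unfolding fl_isomorphic_def by blast
qed

text \<open>The first conjunct leaves all types free and lets the type of points grow. The second
  uses one type for elements and points, so that both sides of the equality are classes of the same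
  kind.\<close>

theorem theorem4p9:
  shows "(\<forall>(I :: 'i set) F (A :: 'i \<Rightarrow> 'a fl_algebra).
            ultrafilter_on I F \<longrightarrow> (\<forall>i\<in>I. A i \<in> RDInFL TYPE('x)) \<longrightarrow>
            ultraproduct I F A \<in> RDInFL TYPE(('i \<Rightarrow> 'x) set))
       \<and> ultraproducts TYPE('j) (RDInFL TYPE('u) :: 'u fl_algebra set)
            = (RDInFL TYPE('u) :: 'u fl_algebra set)"
proof (intro conjI allI impI equalityI ultraproducts_RDInFL_subset)
  fix I :: "'i set" and F and A :: "'i \<Rightarrow> 'a fl_algebra"
  assume uf: "ultrafilter_on I F" and A: "\<forall>i\<in>I. A i \<in> RDInFL TYPE('x)"
  interpret ultraproduct_of F I A using uf A by (rule ultraproduct_of_RDInFL)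
  show "ultraproduct I F A \<in> RDInFL TYPE(('i \<Rightarrow> 'x) set)"
    unfolding RDInFL_iff
    using ultraproduct_closed ultraproduct_of_RDInFL(2)[OF uf A] by blast
next
  show "(RDInFL TYPE('u) :: 'u fl_algebra set)
    \<subseteq> ultraproducts TYPE('j) (RDInFL TYPE('u) :: 'u fl_algebra set)"
  proof
    fix A :: "'u fl_algebra" assume A: "A \<in> RDInFL TYPE('u)"
    then have dinfl: "dinfl A" by (simp add: RDInFL_def)
    \<comment> \<open>Any index serves; types are inhabited, so a one-point index set always
      exists.\<close>
    fix i :: 'j
    have "fl_isomorphic A (ultraproduct {i} (principal {i}) (\<lambda>_. A))"
      using dinfl_closed[OF dinfl] by (rule ultraproduct_principal)
    note witness = ultrafilter_on_principal[of i] A this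
    have "\<exists>(I :: 'j set) F B. ultrafilter_on I F \<and>
        (\<forall>j\<in>I. B j \<in> (RDInFL TYPE('u) :: 'u fl_algebra set)) \<and>
        fl_isomorphic A (ultraproduct I F B)"
      by (rule exI[of _ "{i}"], rule exI[of _ "principal {i}"], rule exI[of _ "\<lambda>_. A"])
        (simp add: witness)
    with dinfl show "A \<in> ultraproducts TYPE('j) (RDInFL TYPE('u) :: 'u fl_algebra set)"
      unfolding ultraproducts_def by simp
  qed
qed

end
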